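(* The set $$\{f \in \mathcal{S}([0,\infty)) : r(f,\alpha) = \infty \text{ for every } \alpha \in \mathbb{R}\}$$ is dense and $\mathcal{G}_\delta$ in the space $\mathcal{S}([0,\infty))$.
   Context: $\mathcal{S}([0,\infty))$ is the space of Schwartz functions on the half-line: the set of complex-valued $f \in C^\infty([0,\infty))$ (smooth up to $0$, with one-sided derivatives there) such that $\rho_\ell(f) < \infty$ for every nonnegative integer $\ell$, where $$\rho_\ell(f) := \sup\left\{(1+t)^\ell \left|\frac{\partial^k f(t)}{\partial t^k}\right| : k \leq \ell,\ t \geq 0\right\}.$$ It is endowed with the topology defined by the norms $\rho_\ell$, $\ell=0,1,2,\ldots$; this is a Fréchet space, completely metrized by $\rho(f,g) := \sum_{\ell} 2^{-\ell} \frac{\rho_\ell(f-g)}{1+\rho_\ell(f-g)}$. For $f \in \mathcal{S}([0,\infty))$ its Fourier-Laplace transform is $\hat{f}(z) = \int_0^\infty e^{-izt} f(t)\,dt$, defined for $z \in \mathbb{C}$ with $\operatorname{Im} z \leq 0$. It is $C^\infty$ on $\{\operatorname{Im} z \leq 0\}$ and holomorphic on $\{\operatorname{Im} z < 0\}$. For $\alpha \in \mathbb{R}$ and $n \in \mathbb{N}=\{1,2,\ldots\}$, $(\hat{f})^{(n)}(\alpha)$ denotes the $n$-th derivative at $x=\alpha$ of the function $x \mapsto \hat f(x)$ of the real variable $x$, i.e. $(\hat{f})^{(n)}(\alpha)=\int_0^\infty e^{-i\alpha t}(-it)^n f(t)\,dt$. Set $$r(f,\alpha) := \limsup_{n \to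 \infty} \sqrt[n]{\frac{|(\hat{f})^{(n)}(\alpha)|}{n!}}.$$ *)

theory Defs
  imports "HOL-Analysis.Analysis"
begin

definition higher_vderiv :: "real set \<Rightarrow> nat \<Rightarrow> (real \<Rightarrow> complex) \<Rightarrow> real \<Rightarrow> complex" where
  "higher_vderiv S k = (\<lambda>g t. vector_derivative g (at t within S)) ^^ k"

text \<open>At \<^term>\<open>0\<close> the derivatives within \<^term>\<open>{0..} :: real set\<close> are the one-sided ones. For \<open>t \<ge> 0\<close>
  only the values of the function on the half-line matter.\<close>

definition smooth_halfline :: "(real \<Rightarrow> complex) \<Rightarrow> bool" where
  "smooth_halfline f \<longleftrightarrow>
     (\<forall>k. \<forall>t\<ge>0. higher_vderiv {0..} k f differentiable (at t within {0..}))"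

definition schwartz_norm :: "nat \<Rightarrow> (real \<Rightarrow> complex) \<Rightarrow> ereal" where
  "schwartz_norm l f =
     Sup {ereal ((1 + t) ^ l * cmod (higher_vderiv {0..} k f t)) | k t. k \<le> l \<and> t \<ge> 0}"

text \<open>A function on the half-line is represented by its extension by \<open>0\<close> to the whole real line, so
  that every element of the space has exactly one representative.  The extension
  itself need not be continuous at \<open>0\<close>.\<close>

definition schwartz_halfline :: "(real \<Rightarrow> complex) set" where
  "schwartz_halfline =
     {f. (\<forall>t<0. f t = 0) \<and> smooth_halfline f \<and> (\<forall>l. schwartz_norm l f < \<infinity>)}"

definition schwartz_ball :: "nat \<Rightarrow> (real \<Rightarrow> complex) \<Rightarrow> real \<Rightarrow> (real \<Rightarrow> complex) set" where
  "schwartz_ball l f e =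
     {g \<in> schwartz_halfline. schwartz_norm l (\<lambda>t. g t - f t) < ereal e}"

definition schwartz_topology :: "(real \<Rightarrow> complex) topology" where
  "schwartz_topology =
     topology_generated_by {schwartz_ball l f e | l f e. f \<in> schwartz_halfline \<and> e > 0}"

text \<open>Meaningful for \<^term>\<open>Im z \<le> 0\<close>.\<close>

definition fourier_laplace :: "(real \<Rightarrow> complex) \<Rightarrow> complex \<Rightarrow> complex" where
  "fourier_laplace f z = (LINT t:{0..}|lborel. exp (- (\<i> * z * complex_of_real t)) * f t)"

definition taylor_growth :: "(real \<Rightarrow> complex) \<Rightarrow> real \<Rightarrow> ereal" where
  "taylor_growth f \<alpha> =
     limsup (\<lambda>n. ereal (root n
       (cmod (higher_vderiv UNIV n (\<lambda>x. fourier_laplace f (complex_of_real x)) \<alpha>) / fact n)))"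

lemma higher_vderiv_zero: "t \<ge> 0 \<Longrightarrow> higher_vderiv {0..} k (\<lambda>_. 0) t = 0"
proof (induction k arbitrary: t)
  case 0
  then show ?case by (simp add: higher_vderiv_def)
next
  case (Suc k)
  have "t islimpt {t<..<t + 1}" by (rule islimpt_greaterThanLessThan1) simp
  then have "t islimpt {0..}"
    by (rule islimpt_subset) (use Suc.prems in auto)
  then have nontriv: "at t within {0..} \<noteq> bot"
    by (simp add: trivial_limit_within)
  have "(higher_vderiv {0..} k (\<lambda>_. 0) has_vector_derivative 0) (at t within {0..})"
  proof (rule has_vector_derivative_transform)
    show "((\<lambda>_. 0) has_vector_derivative 0) (at t within {0..})" by simp
  qed (use Suc in simp_all)
  then show ?case
    using vector_derivative_within[OF nontriv, of _ 0] by (simp add: higher_vderiv_def)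
qed

lemma topspace_schwartz_topology: "topspace schwartz_topology = schwartz_halfline"
proof -
  have "f \<in> schwartz_ball 0 f 1" if "f \<in> schwartz_halfline" for f
  proof -
    have "schwartz_norm 0 (\<lambda>t. f t - f t) \<le> 0"
      unfolding schwartz_norm_def by (rule Sup_least) (auto simp: higher_vderiv_zero)
    then have "schwartz_norm 0 (\<lambda>t. f t - f t) < ereal 1"
      by (rule order.strict_trans1) simp
    with that show ?thesis by (simp add: schwartz_ball_def)
  qed
  then have "schwartz_halfline \<subseteq> \<Union>{schwartz_ball l f e | l f e. f \<in> schwartz_halfline \<and> e > 0}"
    using zero_less_one[where 'a = real] by blast
  then show ?thesis
    unfolding schwartz_topology_def topology_generated_by_topspace
    by (auto simp: schwartz_ball_def)
qed

end

(* On the real line, the n-th derivative of the transform of f is the twisted moment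
   m_n(f, a) = int_0^oo exp(-iat) (-it)^n f(t) dt, which is linear in f and bounded by rho_{n+2}(f).
   Moreover r(f, a) = oo iff no bound |m_n(f, a)| <= C n! K^n holds for all n.

   G_delta: for each N, the f such that for every |a| <= N some n violates the bound with C = K = N
   form an open set, by continuity of m_n in (f, a) and compactness of [-N, N]; the set in question
   is the intersection of these.

   Density: exp(-eps t) f(t) tends to f in S as eps -> 0 and satisfies the bound with K = 1/eps at every
   point, so it suffices to find one h with r(h, a) = oo for all a and to add a small multiple of it.
   Such an h is a lacunary sum of translated humps.  Taking Gamma densities t^m exp(-st) as humps makes
   every twisted moment explicit, with absolute value (n+m)! / |s+ia|^(n+m+1), so none of them vanishes;
   along a sparse subsequence a single summand dominates the n-th moment. *)
theory Submission
  imports Defs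
begin

section \<open>Derivatives on the half-line and the Schwartz seminorms\<close>

text \<open>The obstacle is that one function must have large moments at every real point a,
  although exp(-iat) oscillates across a hump and could cancel its moments. The gamma density with
  rate s = n^2 and exponent m = n^4 has mean about n^2 and width about 1. Twisting replaces the rate
  s by s + ia, and because m = s^2 this costs the n-th moment at most a factor exp(-2 a^2), which
  depends on a but not on n. The same formula bounds the k-th moment of the hump by k! 2^(k+m),
  hence by k! 4^k as soon as k >= m. A hump is thus negligible at orders far beyond its own. Humps
  placed later are negligible because the weight exp(-n) makes any prescribed seminorm of them
  small. The positions are therefore chosen recursively: each n exceeds the fourth power of the
  previous one or equals it, and is so large that the seminorm controlling the previous order is
  tiny.\<close>

abbreviation D :: "nat \<Rightarrow> (real \<Rightarrow> complex) \<Rightarrow> real \<Rightarrow> complex" where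
  "D \<equiv> higher_vderiv {0..}"

lemma at_within_halfline_neq_bot: "t \<ge> 0 \<Longrightarrow> at t within {0::real..} \<noteq> bot"
proof -
  assume t: "t \<ge> 0"
  have "t islimpt {t<..<t + 1}" by (rule islimpt_greaterThanLessThan1) simp
  then have "t islimpt {0..}"
    by (rule islimpt_subset) (use t in auto)
  then show ?thesis
    by (simp add: trivial_limit_within)
qed

text \<open>Explicit candidates for all derivatives at once: checking one step for each
  \<open>k\<close> replaces computations with the iterated \<open>vector_derivative\<close>, which
  is a choice operator. Nothing is asked at negative t, where representatives are cut off to
  0.\<close>

definition deriv_chain :: "(nat \<Rightarrow> real \<Rightarrow> complex) \<Rightarrow> bool" where
  "deriv_chain F \<longleftrightarrow>
     (\<forall>k. \<forall>t\<ge>0. (F k has_vector_derivative F (Suc k) t) (at t within {0..}))"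

lemma deriv_chainD:
  "deriv_chain F \<Longrightarrow> t \<ge> 0 \<Longrightarrow> (F k has_vector_derivative F (Suc k) t) (at t within {0..})"
  by (simp add: deriv_chain_def)

text \<open>Derivatives within the half-line are unique because each of its points, 0 included, is a
  limit point of it.\<close>

lemma higher_vderiv_eq_chain:
  assumes F: "deriv_chain F" and f: "\<forall>t\<ge>0. f t = F 0 t" and "t \<ge> 0"
  shows "D k f t = F k t"
  using \<open>t \<ge> 0\<close>
proof (induction k arbitrary: t)
  case 0
  then show ?case by (simp add: higher_vderiv_def f)
next
  case (Suc k)
  have "(D k f has_vector_derivative F (Suc k) t) (at t within {0..})"
    by (rule has_vector_derivative_transform[OF _ _ deriv_chainD[OF F Suc.prems]])
      (use Suc in auto)
  from vector_derivative_within[OF at_within_halfline_neq_bot[OF Suc.prems] this]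
  show ?case by (simp add: higher_vderiv_def)
qed

lemma smooth_halfline_iff_chain: "smooth_halfline f \<longleftrightarrow> deriv_chain (\<lambda>k. D k f)"
  unfolding smooth_halfline_def deriv_chain_def vector_derivative_works
  by (simp add: higher_vderiv_def)

lemma smooth_halflineI:
  assumes F: "deriv_chain F" and f: "\<forall>t\<ge>0. f t = F 0 t"
  shows "smooth_halfline f"
  unfolding smooth_halfline_iff_chain deriv_chain_def
proof (intro allI impI)
  fix k and t :: real assume t: "t \<ge> 0"
  show "(D k f has_vector_derivative D (Suc k) f t) (at t within {0..})"
    unfolding higher_vderiv_eq_chain[OF F f t]
    by (rule has_vector_derivative_transform[OF _ _ deriv_chainD[OF F t]])
      (use t higher_vderiv_eq_chain[OF F f] in auto)
qed

lemma schwartz_norm_le_iff: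
  "schwartz_norm l f \<le> ereal B \<longleftrightarrow>
     (\<forall>k\<le>l. \<forall>t\<ge>0. (1 + t) ^ l * cmod (D k f t) \<le> B)"
  unfolding schwartz_norm_def Sup_le_iff by (auto 4 4)

lemma schwartz_norm_mono:
  assumes "l \<le> l'" shows "schwartz_norm l f \<le> schwartz_norm l' f"
  unfolding schwartz_norm_def
proof (rule Sup_mono, clarsimp)
  fix k and t :: real assume "k \<le> l" "t \<ge> 0"
  have "(1 + t) ^ l * cmod (D k f t) \<le> (1 + t) ^ l' * cmod (D k f t)"
    by (intro mult_right_mono power_increasing) (use assms \<open>t \<ge> 0\<close> in auto)
  then show "\<exists>b. (\<exists>k t. b = ereal ((1 + t) ^ l' * cmod (D k f t)) \<and> k \<le> l' \<and> 0 \<le> t)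
      \<and> ereal ((1 + t) ^ l * cmod (D k f t)) \<le> b"
    using \<open>k \<le> l\<close> \<open>l \<le> l'\<close> \<open>t \<ge> 0\<close>
    by (intro exI[of _ "ereal ((1 + t) ^ l' * cmod (D k f t))"] conjI exI[of _ k] exI[of _ t]) auto
qed

lemma schwartz_norm_nonneg: "schwartz_norm l f \<ge> 0"
proof -
  have "0 \<le> ereal ((1 + 0) ^ l * cmod (D 0 f 0))" by simp
  also have "\<dots> \<le> schwartz_norm l f"
    unfolding schwartz_norm_def by (rule Sup_upper) force
  finally show ?thesis .
qed

lemma schwartz_halfline_smooth: "f \<in> schwartz_halfline \<Longrightarrow> smooth_halfline f"
  by (simp add: schwartz_halfline_def)

lemma schwartz_norm_boundE:
  assumes "f \<in> schwartz_halfline"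
  obtains B where "B \<ge> 0" "schwartz_norm l f = ereal B"
proof -
  have "schwartz_norm l f < \<infinity>" using assms by (simp add: schwartz_halfline_def)
  with schwartz_norm_nonneg[of l f] that show thesis
    by (cases "schwartz_norm l f") auto
qed

lemma schwartz_halflineI:
  assumes "\<And>t. t < 0 \<Longrightarrow> f t = 0" and F: "deriv_chain F" and f: "\<forall>t\<ge>0. f t = F 0 t"
    and B: "\<And>l. \<exists>B. \<forall>k\<le>l. \<forall>t\<ge>0. (1 + t) ^ l * cmod (F k t) \<le> B"
  shows "f \<in> schwartz_halfline"
proof -
  have "schwartz_norm l f < \<infinity>" for l
  proof -
    obtain B where "\<forall>k\<le>l. \<forall>t\<ge>0. (1 + t) ^ l * cmod (F k t) \<le> B" using B by blast
    then have "schwartz_norm l f \<le> ereal B"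
      by (simp add: schwartz_norm_le_iff higher_vderiv_eq_chain[OF F f])
    then show ?thesis by (rule order.strict_trans1) simp
  qed
  with assms smooth_halflineI[OF F f] show ?thesis by (simp add: schwartz_halfline_def)
qed

lemma
  assumes f: "smooth_halfline f" and g: "smooth_halfline g"
  shows deriv_chain_lincomb: "deriv_chain (\<lambda>k t. D k f t + c * D k g t)"
    and higher_vderiv_lincomb: "t \<ge> 0 \<Longrightarrow> D k (\<lambda>t. f t + c * g t) t = D k f t + c * D k g t"
proof -
  show *: "deriv_chain (\<lambda>k t. D k f t + c * D k g t)"
    using f g unfolding smooth_halfline_iff_chain deriv_chain_def
    by (auto intro!: derivative_eq_intros)
  show "t \<ge> 0 \<Longrightarrow> D k (\<lambda>t. f t + c * g t) t = D k f t + c * D k g t"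
    by (rule higher_vderiv_eq_chain[OF *]) (auto simp: higher_vderiv_def)
qed

lemma schwartz_norm_lincomb_le:
  assumes f: "smooth_halfline f" and g: "smooth_halfline g"
    and "schwartz_norm l f \<le> ereal A" "schwartz_norm l g \<le> ereal B"
  shows "schwartz_norm l (\<lambda>t. f t + c * g t) \<le> ereal (A + cmod c * B)"
  unfolding schwartz_norm_le_iff
proof (intro allI impI)
  fix k and t :: real assume "k \<le> l" and t: "t \<ge> 0"
  then have *: "(1 + t) ^ l * cmod (D k f t) \<le> A" "(1 + t) ^ l * cmod (D k g t) \<le> B"
    using assms by (auto simp: schwartz_norm_le_iff)
  have "(1 + t) ^ l * cmod (D k f t + c * D k g t)
      \<le> (1 + t) ^ l * (cmod (D k f t) + cmod c * cmod (D k g t))"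
    using t by (intro mult_left_mono order.trans[OF norm_triangle_ineq]) (auto simp: norm_mult)
  also have "\<dots> = (1 + t) ^ l * cmod (D k f t) + cmod c * ((1 + t) ^ l * cmod (D k g t))"
    by (simp add: algebra_simps)
  also have "\<dots> \<le> A + cmod c * B"
    using * by (intro add_mono mult_left_mono) auto
  finally show "(1 + t) ^ l * cmod (D k (\<lambda>t. f t + c * g t) t) \<le> A + cmod c * B"
    using t by (simp add: higher_vderiv_lincomb f g)
qed

lemma schwartz_halfline_lincomb:
  assumes f: "f \<in> schwartz_halfline" and g: "g \<in> schwartz_halfline"
  shows "(\<lambda>t. f t + c * g t) \<in> schwartz_halfline"
proof -
  note sm = f[THEN schwartz_halfline_smooth] g[THEN schwartz_halfline_smooth]
  have "smooth_halfline (\<lambda>t. f t + c * g t)"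
    by (rule smooth_halflineI[OF deriv_chain_lincomb[OF sm, of c]]) (simp add: higher_vderiv_def)
  moreover have "schwartz_norm l (\<lambda>t. f t + c * g t) < \<infinity>" for l
  proof -
    obtain A B where "schwartz_norm l f = ereal A" "schwartz_norm l g = ereal B"
      by (metis schwartz_norm_boundE f g)
    with schwartz_norm_lincomb_le[OF sm, of l A B c]
    have "schwartz_norm l (\<lambda>t. f t + c * g t) \<le> ereal (A + cmod c * B)" by simp
    then show ?thesis by (rule order.strict_trans1) simp
  qed
  ultimately show ?thesis
    using f g by (simp add: schwartz_halfline_def)
qed

lemma schwartz_halfline_diff:
  "f \<in> schwartz_halfline \<Longrightarrow> g \<in> schwartz_halfline \<Longrightarrow> (\<lambda>t. f t - g t) \<in> schwartz_halfline"
  using schwartz_halfline_lincomb[of f g "-1"] by simp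

lemma schwartz_norm_triangle:
  assumes "smooth_halfline f" "smooth_halfline g"
    and "schwartz_norm l f \<le> ereal A" "schwartz_norm l g \<le> ereal B"
  shows "schwartz_norm l (\<lambda>t. f t + g t) \<le> ereal (A + B)"
  using schwartz_norm_lincomb_le[OF assms, of 1] by simp

section \<open>The topology\<close>

lemma schwartz_ball_center: 
  assumes "f \<in> schwartz_halfline" "e > 0" shows "f \<in> schwartz_ball l f e"
proof -
  have "schwartz_norm l (\<lambda>t. f t - f t) \<le> ereal 0"
    by (simp add: schwartz_norm_le_iff higher_vderiv_zero)
  also have "ereal 0 < ereal e" using assms by simp
  finally show ?thesis using assms by (simp add: schwartz_ball_def)
qed

lemma openin_schwartz_ball:
  "f \<in> schwartz_halfline \<Longrightarrow> e > 0 \<Longrightarrow> openin schwartz_topology (schwartz_ball l f e)"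
  unfolding schwartz_topology_def by (rule topology_generated_by_Basis) blast

lemma schwartz_ball_subset_ball:
  assumes f0: "f0 \<in> schwartz_halfline" and f: "f \<in> schwartz_ball l f0 e"
  shows "\<exists>d>0. schwartz_ball l f d \<subseteq> schwartz_ball l f0 e"
proof -
  have fS: "f \<in> schwartz_halfline" using f by (simp add: schwartz_ball_def)
  obtain B where B: "schwartz_norm l (\<lambda>t. f t - f0 t) = ereal B"
    using schwartz_norm_boundE[OF schwartz_halfline_diff[OF fS f0]] by blast
  have "B < e" using f B by (simp add: schwartz_ball_def)
  have "schwartz_ball l f (e - B) \<subseteq> schwartz_ball l f0 e"
  proof
    fix g assume g: "g \<in> schwartz_ball l f (e - B)"
    then have gS: "g \<in> schwartz_halfline" by (simp add: schwartz_ball_def)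
    obtain A where A: "schwartz_norm l (\<lambda>t. g t - f t) = ereal A"
      using schwartz_norm_boundE[OF schwartz_halfline_diff[OF gS fS]] by blast
    have "schwartz_norm l (\<lambda>t. (g t - f t) + (f t - f0 t)) \<le> ereal (A + B)"
      using A B schwartz_halfline_diff f0 fS gS
      by (intro schwartz_norm_triangle schwartz_halfline_smooth) auto
    also have "\<dots> < ereal e" using g A by (simp add: schwartz_ball_def)
    finally show "g \<in> schwartz_ball l f0 e" using gS by (simp add: schwartz_ball_def)
  qed
  with \<open>B < e\<close> show ?thesis by (intro exI[of _ "e - B"]) auto
qed

lemma schwartz_ball_mono:
  assumes "l \<le> l'" "d' \<le> d" shows "schwartz_ball l' f d' \<subseteq> schwartz_ball l f d"
proof
  fix g assume g: "g \<in> schwartz_ball l' f d'"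
  have "schwartz_norm l (\<lambda>t. g t - f t) \<le> schwartz_norm l' (\<lambda>t. g t - f t)"
    by (rule schwartz_norm_mono[OF assms(1)])
  also have "\<dots> < ereal d'" using g by (simp add: schwartz_ball_def)
  also have "\<dots> \<le> ereal d" using assms(2) by simp
  finally show "g \<in> schwartz_ball l f d" using g by (simp add: schwartz_ball_def)
qed

text \<open>The seminorms increase with their index, so two balls around \<open>f\<close> contain
  the ball with the larger index and the smaller radius. This turns the generating balls from a
  subbase into a base.\<close>

lemma openin_schwartz_topology_iff:
  "openin schwartz_topology U \<longleftrightarrow>
     U \<subseteq> schwartz_halfline \<and> (\<forall>f\<in>U. \<exists>l. \<exists>e>0. schwartz_ball l f e \<subseteq> U)"
proof
  assume U: "openin schwartz_topology U"
  have "\<forall>f\<in>U. \<exists>l. \<exists>e>0. schwartz_ball l f e \<subseteq> U"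
    using U unfolding schwartz_topology_def openin_topology_generated_by_iff
  proof (induction rule: generate_topology_on.induct)
    case (Int a b)
    show ?case
    proof
      fix f assume "f \<in> a \<inter> b"
      then obtain l1 e1 l2 e2 where "e1 > 0" "schwartz_ball l1 f e1 \<subseteq> a"
        "e2 > 0" "schwartz_ball l2 f e2 \<subseteq> b" using Int by blast
      moreover have "schwartz_ball (max l1 l2) f (min e1 e2) \<subseteq> schwartz_ball l1 f e1"
        "schwartz_ball (max l1 l2) f (min e1 e2) \<subseteq> schwartz_ball l2 f e2"
        by (rule schwartz_ball_mono; simp)+
      ultimately show "\<exists>l. \<exists>e>0. schwartz_ball l f e \<subseteq> a \<inter> b"
        by (intro exI[of _ "max l1 l2"] exI[of _ "min e1 e2"]) auto
    qed
  next
    case (UN K)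
    then show ?case by (meson Union_iff Union_upper order_trans)
  next
    case (Basis s)
    then show ?case using schwartz_ball_subset_ball by blast
  qed simp
  with openin_subset[OF U] show "U \<subseteq> schwartz_halfline \<and> (\<forall>f\<in>U. \<exists>l. \<exists>e>0. schwartz_ball l f e \<subseteq> U)"
    by (simp add: topspace_schwartz_topology)
next
  assume U: "U \<subseteq> schwartz_halfline \<and> (\<forall>f\<in>U. \<exists>l. \<exists>e>0. schwartz_ball l f e \<subseteq> U)"
  show "openin schwartz_topology U"
  proof (subst openin_subopen, intro ballI)
    fix f assume "f \<in> U"
    with U obtain l e where "e > 0" "schwartz_ball l f e \<subseteq> U" "f \<in> schwartz_halfline" by blast
    then show "\<exists>T. openin schwartz_topology T \<and> f \<in> T \<and> T \<subseteq> U"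
      by (intro exI[of _ "schwartz_ball l f e"] conjI openin_schwartz_ball schwartz_ball_center)
  qed
qed

text \<open>This plays the role of completeness. A majorant of the seminorm of index l dominates all
  derivatives of order up to l, so by the Weierstrass test every derived series converges uniformly
  and the sum may be differentiated termwise.\<close>

lemma schwartz_norm_suminf:
  assumes \<psi>: "\<And>i. \<psi> i \<in> schwartz_halfline"
    and sM: "\<And>l. summable (M l)"
    and M: "\<And>l i. schwartz_norm l (\<psi> i) \<le> ereal (M l i)"
  shows "(\<lambda>t. \<Sum>i. \<psi> i t) \<in> schwartz_halfline"
    and "schwartz_norm l (\<lambda>t. \<Sum>i. \<psi> i t) \<le> ereal (\<Sum>i. M l i)"
    and "t \<ge> 0 \<Longrightarrow> summable (\<lambda>i. \<psi> i t)"
proof -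
  define F where "F k t = (\<Sum>i. D k (\<psi> i) t)" for k t
  have w: "(1 + t) ^ l * cmod (D k (\<psi> i) t) \<le> M l i" if "k \<le> l" "t \<ge> 0" for k l i t
    using M[of l i] that by (simp add: schwartz_norm_le_iff)
  have b: "cmod (D k (\<psi> i) t) \<le> M l i" if "k \<le> l" "t \<ge> 0" for k l i t
  proof -
    have "1 * cmod (D k (\<psi> i) t) \<le> (1 + t) ^ l * cmod (D k (\<psi> i) t)"
      by (intro mult_right_mono) (use that in auto)
    with w[OF that] show ?thesis by (metis mult_1 order_trans)
  qed
  have sumD: "summable (\<lambda>i. D k (\<psi> i) t)" if "t \<ge> 0" for k t
    by (rule summable_comparison_test'[OF sM[of k], of 0]) (use b that in auto)
  have chain: "deriv_chain F"
    unfolding deriv_chain_def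
  proof (intro allI impI)
    fix k and t :: real assume t: "t \<ge> 0"
    have u: "uniform_limit {0..} (\<lambda>n x. \<Sum>i<n. D (Suc k) (\<psi> i) x) (F (Suc k)) sequentially"
      unfolding F_def by (rule Weierstrass_m_test[OF _ sM[of "Suc k"]]) (use b in auto)
    have "\<exists>g. \<forall>x\<in>{0..}. (\<lambda>i. D k (\<psi> i) x) sums g x \<and>
        (g has_derivative (\<lambda>h. h *\<^sub>R F (Suc k) x)) (at x within {0..})"
    \<comment> \<open>Termwise differentiation asks for convergence of the undifferentiated series
      at a single point; 0 is taken.\<close>
    proof (rule has_derivative_series[where f' = "\<lambda>i x h. h *\<^sub>R D (Suc k) (\<psi> i) x" and x = 0])
      show "((D k (\<psi> i)) has_derivative (\<lambda>h. h *\<^sub>R D (Suc k) (\<psi> i) x)) (at x within {0..})"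
        if "x \<in> {0..}" for i x
        using \<psi>[THEN schwartz_halfline_smooth, of i] that
        unfolding smooth_halfline_iff_chain deriv_chain_def has_vector_derivative_def by auto
      show "\<forall>\<^sub>F n in sequentially. \<forall>x\<in>{0..}. \<forall>h.
          norm ((\<Sum>i<n. h *\<^sub>R D (Suc k) (\<psi> i) x) - h *\<^sub>R F (Suc k) x) \<le> e * norm h"
        if "e > 0" for e
        using uniform_limitD[OF u that]
      proof eventually_elim
        case (elim n)
        then show ?case
          by (auto simp: dist_norm mult.commute[of "\<bar>_\<bar>"]
              simp flip: scaleR_right.sum scaleR_right_diff_distrib
              intro!: mult_right_mono intro: less_imp_le)
      qed
      show "(\<lambda>i. D k (\<psi> i) 0) sums F k 0" unfolding F_def by (rule summable_sums[OF sumD]) simp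
    qed (simp_all add: convex_real_interval)
    then obtain g where "\<forall>x\<in>{0..}. (\<lambda>i. D k (\<psi> i) x) sums g x \<and>
        (g has_derivative (\<lambda>h. h *\<^sub>R F (Suc k) x)) (at x within {0..})" ..
    then have g: "\<And>x. x \<ge> 0 \<Longrightarrow> (\<lambda>i. D k (\<psi> i) x) sums g x"
      "\<And>x. x \<ge> 0 \<Longrightarrow> (g has_vector_derivative F (Suc k) x) (at x within {0..})"
      unfolding has_vector_derivative_def by simp_all
    have "F k x = g x" if "x \<ge> 0" for x
      using g(1)[OF that] by (simp add: F_def sums_iff)
    then show "(F k has_vector_derivative F (Suc k) t) (at t within {0..})"
      by (intro has_vector_derivative_transform[OF _ _ g(2)[OF t]]) (use t in auto)
  qed
  have F0: "\<forall>t\<ge>0. (\<Sum>i. \<psi> i t) = F 0 t" by (simp add: F_def higher_vderiv_def)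
  have bd: "(1 + t) ^ l * cmod (F k t) \<le> (\<Sum>i. M l i)" if "k \<le> l" "t \<ge> 0" for k l t
  proof -
    have "(1 + t) ^ l * cmod (F k t) = cmod (\<Sum>i. complex_of_real ((1 + t) ^ l) * D k (\<psi> i) t)"
      unfolding F_def using that
      by (subst suminf_mult[OF sumD]) (auto simp: norm_mult norm_power simp del: of_real_power)
    also have "\<dots> \<le> (\<Sum>i. M l i)"
      by (rule norm_suminf_le[OF _ sM]) (use w that in \<open>auto simp: norm_mult norm_power simp flip: of_real_power\<close>)
    finally show ?thesis .
  qed
  show "t \<ge> 0 \<Longrightarrow> summable (\<lambda>i. \<psi> i t)"
    using sumD[of t 0] by (simp add: higher_vderiv_def)
  show "(\<lambda>t. \<Sum>i. \<psi> i t) \<in> schwartz_halfline"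
    by (rule schwartz_halflineI[OF _ chain F0])
      (use bd \<psi> in \<open>auto simp: schwartz_halfline_def\<close>)
  show "schwartz_norm l (\<lambda>t. \<Sum>i. \<psi> i t) \<le> ereal (\<Sum>i. M l i)"
    using bd by (simp add: schwartz_norm_le_iff higher_vderiv_eq_chain[OF chain F0])
qed


section \<open>Moments\<close>

lemma has_bochner_integral_inverse_square:
  "has_bochner_integral lborel (\<lambda>t::real. indicator {0..} t *\<^sub>R (1 / (1 + t)\<^sup>2)) 1"
proof (rule has_bochner_integral_nn_integral)
  have "(\<integral>\<^sup>+ t. ennreal (1 / (1 + t)\<^sup>2) * indicator {0..} t \<partial>lborel) = ennreal (0 - (- 1 / (1 + 0)))"
  proof (rule nn_integral_FTC_atLeast)
    show "((\<lambda>t. - 1 / (1 + t)) has_real_derivative 1 / (1 + x)\<^sup>2) (at x)" if "0 \<le> x" for x :: real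
      using that by (auto intro!: derivative_eq_intros simp: power2_eq_square)
    have "((\<lambda>t::real. - inverse (1 + t)) \<longlongrightarrow> - 0) at_top"
      by (intro tendsto_minus tendsto_inverse_0_at_top filterlim_tendsto_add_at_top[OF tendsto_const] filterlim_ident)
    then show "((\<lambda>t::real. - 1 / (1 + t)) \<longlongrightarrow> 0) at_top" by (simp add: field_simps)
  qed auto
  then show "(\<integral>\<^sup>+ t. ennreal (indicator {0..} t *\<^sub>R (1 / (1 + t)\<^sup>2)) \<partial>lborel) = ennreal 1"
    by (subst nn_integral_cong[where v = "\<lambda>t. ennreal (1 / (1 + t)\<^sup>2) * indicator {0..} t"])
      (auto simp: indicator_def)
qed auto

text \<open>The comparison function \<open>B / (1 + t)\<^sup>2\<close> has integral exactly
  \<open>B\<close>, which is why the bound carries over without a constant.\<close>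

lemma
  fixes g :: "real \<Rightarrow> complex"
  assumes cont: "continuous_on {0..} g" and B: "\<And>t. t \<ge> 0 \<Longrightarrow> (1 + t)\<^sup>2 * cmod (g t) \<le> B"
  shows set_integrable_quadratic_decay: "set_integrable lborel {0..} g"
    and cmod_integral_quadratic_decay: "cmod (LINT t:{0..}|lborel. g t) \<le> B"
proof -
  have le: "cmod (g t) \<le> B * (1 / (1 + t)\<^sup>2)" if "t \<ge> 0" for t
    using B[OF that] that by (simp add: field_simps)
  have "0 \<le> B" using order_trans[OF _ B[of 0]] by simp
  note h = has_bochner_integral_mult_right[OF has_bochner_integral_inverse_square, of B]
  have iB: "integrable lborel (\<lambda>t::real. B * (indicator {0..} t *\<^sub>R (1 / (1 + t)\<^sup>2)))"
    and eB: "(LINT t|lborel. B * (indicator {0..} t *\<^sub>R (1 / (1 + t)\<^sup>2))) = B"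
    using h by (auto simp: has_bochner_integral_iff)
  show int: "set_integrable lborel {0..} g"
    unfolding set_integrable_def
  proof (rule Bochner_Integration.integrable_bound[OF iB])
    show "(\<lambda>t. indicator {0..} t *\<^sub>R g t) \<in> borel_measurable lborel"
      using borel_measurable_continuous_on_indicator[OF _ cont] by simp
    show "AE t in lborel. norm (indicator {0..} t *\<^sub>R g t) \<le> norm (B * (indicator {0..} t *\<^sub>R (1 / (1 + t)\<^sup>2)))"
      using le \<open>0 \<le> B\<close> by (intro always_eventually) (auto simp: indicator_def)
  qed
  have "cmod (LINT t:{0..}|lborel. g t) \<le> (LINT t|lborel. norm (indicator {0..} t *\<^sub>R g t))"
    unfolding set_lebesgue_integral_def by (rule integral_norm_bound)
  also have "\<dots> \<le> (LINT t|lborel. B * (indicator {0..} t *\<^sub>R (1 / (1 + t)\<^sup>2)))"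
    using le integrable_norm[OF int[unfolded set_integrable_def]]
    by (intro integral_mono[OF _ iB]) (auto simp: indicator_def)
  finally show "cmod (LINT t:{0..}|lborel. g t) \<le> B" unfolding eB .
qed

lemma set_integral_FTC_atLeast:
  fixes G g :: "real \<Rightarrow> complex"
  assumes "\<And>t. (G has_vector_derivative g t) (at t)" "continuous_on UNIV g"
    "set_integrable lborel {0..} g" "(G \<longlongrightarrow> L) at_top"
  shows "(LINT t:{0..}|lborel. g t) = L - G 0"
proof -
  have "((\<lambda>b. G b - G 0) \<longlongrightarrow> (LINT t:{0..}|lborel. g t)) at_top"
  proof (rule Lim_transform_eventually[OF tendsto_set_lebesgue_integral_at_top[OF _ assms(3)]])
    show "\<forall>\<^sub>F b in at_top. (LINT t:{0..b}|lborel. g t) = G b - G 0"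
      using eventually_ge_at_top[of 0]
    proof eventually_elim
      case (elim b)
      show ?case unfolding set_lebesgue_integral_def
        by (rule integral_FTC_Icc[OF elim])
          (use assms(1,2) in \<open>auto intro: has_vector_derivative_at_within continuous_on_subset\<close>)
    qed
  qed simp
  moreover have "((\<lambda>b. G b - G 0) \<longlongrightarrow> L - G 0) at_top"
    by (intro tendsto_diff assms(4) tendsto_const)
  ultimately show ?thesis by (intro tendsto_unique) auto
qed

section \<open>Euler's integral with a complex rate\<close>

lemma power_le_fact_exp:
  assumes "x \<ge> 0" shows "x ^ p \<le> fact p * exp (x::real)"
proof -
  have "(\<Sum>k\<in>{p}. x ^ k / fact k) \<le> (\<Sum>k. x ^ k / fact k)"
    by (rule sum_le_suminf) (use assms summable_exp_generic[of x] in \<open>auto simp: divide_inverse mult.commute\<close>)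
  also have "\<dots> = exp x" by (simp add: exp_def divide_inverse mult.commute)
  finally show ?thesis by (simp add: field_simps)
qed

lemma power_mult_exp_minus_le:
  assumes "t \<ge> 0" "(\<sigma>::real) > 0" shows "t ^ p * exp (- \<sigma> * t) \<le> fact p / \<sigma> ^ p"
proof -
  have "(\<sigma> * t) ^ p \<le> fact p * exp (\<sigma> * t)" by (rule power_le_fact_exp) (use assms in simp)
  then show ?thesis using assms by (simp add: exp_minus field_simps power_mult_distrib)
qed

lemma shifted_power_mult_exp_minus_le:
  assumes "t \<ge> 0" "(\<sigma>::real) > 0"
  shows "(1 + t) ^ p * exp (- \<sigma> * t) \<le> exp \<sigma> * (fact p / \<sigma> ^ p)"
proof -
  have "(1 + t) ^ p * exp (- \<sigma> * t) = exp \<sigma> * ((1 + t) ^ p * exp (- \<sigma> * (1 + t)))"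
  proof -
    have "exp (- \<sigma> * t) = exp \<sigma> * exp (- \<sigma> * (1 + t))"
      by (simp add: algebra_simps flip: exp_add)
    then show ?thesis by simp
  qed
  also have "\<dots> \<le> exp \<sigma> * (fact p / \<sigma> ^ p)"
    using assms by (intro mult_left_mono power_mult_exp_minus_le) auto
  finally show ?thesis .
qed

lemma tendsto_power_mult_exp_minus:
  assumes "Re z > 0"
  shows "((\<lambda>t::real. of_real t ^ n * exp (- z * of_real t)) \<longlongrightarrow> 0) at_top"
proof (rule Lim_null_comparison)
  show "\<forall>\<^sub>F t in at_top. norm (of_real t ^ n * exp (- z * of_real t))
      \<le> (fact (Suc n) / Re z ^ Suc n) * inverse t"
    using eventually_gt_at_top[of 0]
  proof eventually_elim
    case (elim t)
    have "t ^ Suc n * exp (- Re z * t) \<le> fact (Suc n) / Re z ^ Suc n"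
      using elim assms by (intro power_mult_exp_minus_le) auto
    then have "t ^ n * exp (- Re z * t) \<le> fact (Suc n) / Re z ^ Suc n / t"
      using elim by (subst pos_le_divide_eq) (simp_all add: mult_ac)
    then show ?case using elim by (simp add: norm_mult norm_power divide_inverse)
  qed
  show "((\<lambda>t. fact (Suc n) / Re z ^ Suc n * inverse t) \<longlongrightarrow> 0) at_top"
    by (rule tendsto_mult_right_zero[OF tendsto_inverse_0_at_top[OF filterlim_ident]])
qed

lemma set_integrable_power_mult_exp:
  assumes "Re z > 0"
  shows "set_integrable lborel {0..} (\<lambda>t. of_real t ^ n * exp (- z * of_real t))"
proof (rule set_integrable_quadratic_decay)
  fix t :: real assume t: "t \<ge> 0"
  have "(1 + t)\<^sup>2 * cmod (of_real t ^ n * exp (- z * of_real t))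
      \<le> (1 + t)\<^sup>2 * ((1 + t) ^ n * exp (- Re z * t))"
    using t by (auto simp: norm_mult norm_power intro!: mult_left_mono mult_right_mono power_mono)
  also have "\<dots> = (1 + t) ^ (n + 2) * exp (- Re z * t)"
    by (simp add: power_add power2_eq_square mult_ac)
  also have "\<dots> \<le> exp (Re z) * (fact (n + 2) / Re z ^ (n + 2))"
    by (rule shifted_power_mult_exp_minus_le[OF t assms])
  finally show "(1 + t)\<^sup>2 * cmod (of_real t ^ n * exp (- z * of_real t)) \<le> \<dots>" .
qed (intro continuous_intros)

text \<open>Integration by parts yields the recursion for complex \<open>z\<close> directly, so no
  contour has to be rotated from the real case.\<close>

lemma integral_power_mult_exp:
  assumes "Re z > 0"
  shows "(LINT t:{0..}|lborel. of_real t ^ n * exp (- z * of_real t)) = fact n / z ^ Suc n"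
proof (induction n)
  have "z \<noteq> 0" using assms by auto
  note [simp] = this
  {
    case 0
    have "(LINT t:{0..}|lborel. z * (of_real t ^ 0 * exp (- z * of_real t))) = 0 - - exp (- z * of_real 0)"
    proof (rule set_integral_FTC_atLeast)
      show "((\<lambda>t. - exp (- z * of_real t)) has_vector_derivative
          z * (of_real t ^ 0 * exp (- z * of_real t))) (at t)" for t
        by (auto intro!: derivative_eq_intros has_vector_derivative_real_field)
      show "((\<lambda>t. - exp (- z * of_real t)) \<longlongrightarrow> 0) at_top"
        using tendsto_minus[OF tendsto_power_mult_exp_minus[OF assms, of 0]] by simp
    qed (use set_integrable_power_mult_exp[OF assms, of 0] in \<open>auto intro!: continuous_intros\<close>)
    then show ?case by (simp add: field_simps)
  next
    case (Suc n)
    \<comment> \<open>The integrand is the derivative of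
      \<open>- (t ^ Suc n * exp (- z * t))\<close>, which vanishes at 0 and at infinity; what
      remains is z I_(n+1) = (n+1) I_n.\<close>
    have "(LINT t:{0..}|lborel. z * (of_real t ^ Suc n * exp (- z * of_real t))
          - of_nat (Suc n) * (of_real t ^ n * exp (- z * of_real t)))
        = 0 - - (of_real 0 ^ Suc n * exp (- z * of_real 0))"
    proof (rule set_integral_FTC_atLeast)
      show "((\<lambda>t. - (of_real t ^ Suc n * exp (- z * of_real t))) has_vector_derivative
          z * (of_real t ^ Suc n * exp (- z * of_real t))
          - of_nat (Suc n) * (of_real t ^ n * exp (- z * of_real t))) (at t)" for t :: real
        by (rule has_vector_derivative_real_field)
          (rule derivative_eq_intros refl | simp del: of_nat_Suc power_Suc add: power_Suc algebra_simps)+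
      show "((\<lambda>t. - (of_real t ^ Suc n * exp (- z * of_real t))) \<longlongrightarrow> 0) at_top"
        using tendsto_minus[OF tendsto_power_mult_exp_minus[OF assms, of "Suc n"]] by simp
    qed (intro continuous_intros set_integral_diff set_integrable_mult_right set_integrable_power_mult_exp assms)+
    moreover have "set_integrable lborel {0..} (\<lambda>t. c * (of_real t ^ k * exp (- z * of_real t)))" for c k
      using set_integrable_power_mult_exp[OF assms] by simp
    ultimately have "z * (LINT t:{0..}|lborel. of_real t ^ Suc n * exp (- z * of_real t))
        = of_nat (Suc n) * (LINT t:{0..}|lborel. of_real t ^ n * exp (- z * of_real t))"
      by (subst (asm) set_integral_diff(2)) (auto simp del: power_Suc of_nat_Suc)
    then show ?case unfolding Suc.IH by (simp add: field_simps)
  }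
qed

section \<open>Twisted moments and the growth of Taylor coefficients\<close>

definition moment :: "nat \<Rightarrow> (real \<Rightarrow> complex) \<Rightarrow> real \<Rightarrow> complex" where
  "moment n f x = (LINT t:{0..}|lborel.
     exp (- (\<i> * of_real x * of_real t)) * (- (\<i> * of_real t)) ^ n * f t)"

lemma continuous_on_schwartz_halfline:
  assumes "f \<in> schwartz_halfline" shows "continuous_on {0..} f"
proof -
  have "deriv_chain (\<lambda>k. D k f)"
    using schwartz_halfline_smooth[OF assms] by (simp add: smooth_halfline_iff_chain)
  from deriv_chainD[OF this, of _ 0] have "continuous_on {0..} (D 0 f)"
    by (auto simp: continuous_on_eq_continuous_within intro: has_vector_derivative_continuous)
  then show ?thesis by (simp add: higher_vderiv_def)
qed

lemma
  assumes f: "f \<in> schwartz_halfline"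
    and B: "\<And>t. t \<ge> 0 \<Longrightarrow> (1 + t)\<^sup>2 * (t ^ n * cmod (f t)) \<le> B"
  shows moment_integrand_integrable': "set_integrable lborel {0..}
      (\<lambda>t. exp (- (\<i> * of_real x * of_real t)) * (- (\<i> * of_real t)) ^ n * f t)"
    and cmod_moment_le_weight: "cmod (moment n f x) \<le> B"
proof -
  have c: "continuous_on {0..} (\<lambda>t. exp (- (\<i> * of_real x * of_real t)) * (- (\<i> * of_real t)) ^ n * f t)"
    by (intro continuous_intros continuous_on_schwartz_halfline f)
  have b: "(1 + t)\<^sup>2 * cmod (exp (- (\<i> * of_real x * of_real t)) * (- (\<i> * of_real t)) ^ n * f t) \<le> B"
    if "t \<ge> 0" for t
    using B[OF that] that by (simp add: norm_mult norm_power)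
  show "set_integrable lborel {0..}
      (\<lambda>t. exp (- (\<i> * of_real x * of_real t)) * (- (\<i> * of_real t)) ^ n * f t)"
    and "cmod (moment n f x) \<le> B"
    unfolding moment_def using set_integrable_quadratic_decay[OF c b] cmod_integral_quadratic_decay[OF c b]
    by auto
qed

text \<open>The two extra powers of \<open>1 + t\<close> pay for integrability against
  \<open>1 / (1 + t)\<^sup>2\<close>; hence the index \<open>n + 2\<close> wherever a seminorm
  controls the \<open>n\<close>-th moment.\<close>

lemma schwartz_weight_le:
  assumes "schwartz_norm (n + 2) f \<le> ereal B" "t \<ge> 0"
  shows "(1 + t)\<^sup>2 * (t ^ n * cmod (f t)) \<le> B"
proof -
  have "(1 + t)\<^sup>2 * (t ^ n * cmod (f t)) \<le> (1 + t)\<^sup>2 * ((1 + t) ^ n * cmod (f t))"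
    using assms by (intro mult_left_mono mult_right_mono power_mono) auto
  also have "\<dots> = (1 + t) ^ (n + 2) * cmod (D 0 f t)"
    by (simp add: power_add power2_eq_square higher_vderiv_def mult_ac)
  also have "\<dots> \<le> B" using assms by (auto simp: schwartz_norm_le_iff)
  finally show ?thesis .
qed

lemma cmod_moment_le:
  assumes "f \<in> schwartz_halfline" "schwartz_norm (n + 2) f \<le> ereal B"
  shows "cmod (moment n f x) \<le> B"
  using assms by (intro cmod_moment_le_weight schwartz_weight_le)

lemma moment_integrand_integrable:
  assumes "f \<in> schwartz_halfline"
  shows "set_integrable lborel {0..}
      (\<lambda>t. exp (- (\<i> * of_real x * of_real t)) * (- (\<i> * of_real t)) ^ n * f t)"
proof -
  obtain B where "schwartz_norm (n + 2) f = ereal B" using schwartz_norm_boundE[OF assms] by blast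
  then show ?thesis
    using assms by (intro moment_integrand_integrable' schwartz_weight_le) auto
qed

lemma moment_lincomb:
  assumes "f \<in> schwartz_halfline" "g \<in> schwartz_halfline"
  shows "moment n (\<lambda>t. f t + c * g t) x = moment n f x + c * moment n g x"
proof -
  have "moment n (\<lambda>t. f t + c * g t) x =
    (LINT t:{0..}|lborel. exp (- (\<i> * of_real x * of_real t)) * (- (\<i> * of_real t)) ^ n * f t
      + c * (exp (- (\<i> * of_real x * of_real t)) * (- (\<i> * of_real t)) ^ n * g t))"
    unfolding moment_def by (simp add: algebra_simps)
  also have "\<dots> = moment n f x + c * moment n g x"
    unfolding moment_def
    by (subst set_integral_add) (use moment_integrand_integrable[OF assms(1)] moment_integrand_integrable[OF assms(2)] in auto)
  finally show ?thesis .
qed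

text \<open>Instead of dominated convergence, the first-order Taylor remainder of the exponential is
  bounded by the square of its argument. This costs two more powers of t, paid by the seminorm of
  index \<open>n + 2 + 2\<close>, and gives a remainder of order (y - x)^2.\<close>

lemma has_vector_derivative_moment:
  assumes f: "f \<in> schwartz_halfline"
  shows "(moment n f has_vector_derivative moment (Suc n) f x) (at x)"
proof -
  obtain B where B: "schwartz_norm (n + 2 + 2) f = ereal B" using schwartz_norm_boundE[OF f] by blast
  let ?k = "\<lambda>n x t. exp (- (\<i> * complex_of_real x * complex_of_real t)) * (- (\<i> * complex_of_real t)) ^ n * f t"
  have quad: "cmod (moment n f y - moment n f x - (y - x) *\<^sub>R moment (Suc n) f x) \<le> (y - x)\<^sup>2 * B" for y
  proof -
    have "moment n f y - moment n f x - (y - x) *\<^sub>R moment (Suc n) f x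
        = (LINT t:{0..}|lborel. ?k n y t - ?k n x t - of_real (y - x) * ?k (Suc n) x t)"
      unfolding moment_def scaleR_conv_of_real
      by (subst set_integral_diff, (intro set_integral_diff set_integrable_mult_right moment_integrand_integrable f)+)
        (subst set_integral_diff, (intro moment_integrand_integrable f)+, subst set_integral_mult_right, rule refl)
    also have "cmod \<dots> \<le> (y - x)\<^sup>2 * B"
    proof (rule cmod_integral_quadratic_decay)
      show "continuous_on {0..} (\<lambda>t. ?k n y t - ?k n x t - of_real (y - x) * ?k (Suc n) x t)"
        by (intro continuous_intros continuous_on_schwartz_halfline f)
      fix t :: real assume t: "t \<ge> 0"
      define w where "w = - (\<i> * of_real ((y - x) * t))"
      have "exp (- (\<i> * complex_of_real y * complex_of_real t))
          = exp (- (\<i> * complex_of_real x * complex_of_real t)) * exp w"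
        by (simp add: w_def algebra_simps flip: exp_add)
      then have eq: "?k n y t - ?k n x t - of_real (y - x) * ?k (Suc n) x t = ?k n x t * (exp w - (1 + w))"
        by (simp add: w_def algebra_simps)
      \<comment> \<open>Since \<open>w\<close> is purely imaginary, the exponential factor in the
        general Taylor bound is 1.\<close>
      have "cmod (exp w - (1 + w)) \<le> (cmod w)\<^sup>2"
        using Taylor_exp[of w 1] by (simp add: w_def power2_eq_square)
      also have "\<dots> = (y - x)\<^sup>2 * t\<^sup>2" by (simp add: w_def norm_mult power_mult_distrib flip: of_real_diff)
      finally have e: "cmod (exp w - (1 + w)) \<le> (y - x)\<^sup>2 * t\<^sup>2" .
      have "(1 + t)\<^sup>2 * cmod (?k n x t * (exp w - (1 + w))) \<le> (1 + t)\<^sup>2 * ((t ^ n * cmod (f t)) * ((y - x)\<^sup>2 * t\<^sup>2))"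
        using t e by (auto simp: norm_mult norm_power intro!: mult_left_mono mult_mono)
      also have "\<dots> = (y - x)\<^sup>2 * ((1 + t)\<^sup>2 * (t ^ (n + 2) * cmod (f t)))"
        by (simp add: power_add power2_eq_square mult_ac)
      also have "\<dots> \<le> (y - x)\<^sup>2 * B"
        using schwartz_weight_le[OF _ t, of "n + 2" f B] B by (intro mult_left_mono) auto
      finally show "(1 + t)\<^sup>2 * cmod (?k n y t - ?k n x t - of_real (y - x) * ?k (Suc n) x t) \<le> (y - x)\<^sup>2 * B"
        unfolding eq .
    qed
    finally show ?thesis .
  qed
  have "((\<lambda>y. \<bar>y - x\<bar> * B) \<longlongrightarrow> 0) (at x)"
    by (rule tendsto_mult_left_zero) (rule tendsto_rabs_zero, rule LIM_zero, rule tendsto_ident_at)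
  moreover have "norm (moment n f y - moment n f x - (y - x) *\<^sub>R moment (Suc n) f x) / norm (y - x) \<le> \<bar>y - x\<bar> * B"
    if "y \<noteq> x" for y
  proof -
    have eq: "\<bar>y - x\<bar> * B * norm (y - x) = (y - x)\<^sup>2 * B"
      unfolding power2_abs[of "y - x", symmetric] by (simp only: power2_eq_square real_norm_def mult_ac)
    have pos: "norm (y - x) > 0" using that by simp
    show ?thesis unfolding pos_divide_le_eq[OF pos] eq by (rule quad)
  qed
  ultimately show ?thesis unfolding has_vector_derivative_def
    by (intro has_derivativeI_sandwich[OF zero_less_one bounded_linear_scaleR_left])
qed

lemma higher_vderiv_fourier_laplace:
  assumes "f \<in> schwartz_halfline"
  shows "higher_vderiv UNIV n (\<lambda>x. fourier_laplace f (of_real x)) = moment n f"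
proof (induction n)
  case 0
  show ?case by (simp add: higher_vderiv_def moment_def fourier_laplace_def fun_eq_iff)
next
  case (Suc n)
  have "higher_vderiv UNIV (Suc n) (\<lambda>x. fourier_laplace f (of_real x)) =
     (\<lambda>t. vector_derivative (higher_vderiv UNIV n (\<lambda>x. fourier_laplace f (of_real x))) (at t))"
    by (simp add: higher_vderiv_def)
  also have "\<dots> = moment (Suc n) f"
    unfolding Suc.IH using has_vector_derivative_moment[OF assms] by (auto intro: vector_derivative_at)
  finally show ?case .
qed

text \<open>Trading the limsup of roots for the failure of all geometric bounds leaves conditions
  that are linear in the moments up to a norm. They can then be perturbed, added and passed to
  limits.\<close>

lemma taylor_growth_eq_infinity_iff:
  assumes "f \<in> schwartz_halfline"
  shows "taylor_growth f \<alpha> = \<infinity> \<longleftrightarrow>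
     (\<forall>C\<ge>0. \<forall>K\<ge>0. \<exists>n. cmod (moment n f \<alpha>) > C * (fact n * K ^ n))"
proof -
  define a where "a n = cmod (moment n f \<alpha>) / fact n" for n
  have a0: "a n \<ge> 0" for n by (simp add: a_def)
  have eq: "taylor_growth f \<alpha> = limsup (\<lambda>n. ereal (root n (a n)))"
    unfolding taylor_growth_def higher_vderiv_fourier_laplace[OF assms] a_def by simp
  have a_iff: "cmod (moment n f \<alpha>) \<le> C * (fact n * K ^ n) \<longleftrightarrow> a n \<le> C * K ^ n" for n C K
    by (simp add: a_def field_simps)
  have "taylor_growth f \<alpha> < \<infinity> \<longleftrightarrow> (\<exists>C\<ge>0. \<exists>K\<ge>0. \<forall>n. a n \<le> C * K ^ n)"
  proof
    assume "taylor_growth f \<alpha> < \<infinity>"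
    then obtain R where "taylor_growth f \<alpha> < ereal R" "ereal R < \<infinity>"
      using ereal_dense2 by blast
    then have "\<forall>\<^sub>F n in sequentially. ereal (root n (a n)) < ereal R"
      unfolding eq by (rule_tac Limsup_lessD)
    then obtain N where N: "\<And>n. n \<ge> N \<Longrightarrow> root n (a n) < R"
      by (auto simp: eventually_sequentially)
    define K where "K = max 1 R"
    \<comment> \<open>The sum absorbs the finitely many coefficients before the limsup bound takes
      effect.\<close>
    define C where "C = 1 + (\<Sum>n\<le>N. a n)"
    have K: "K \<ge> 1" by (simp add: K_def)
    have C: "C \<ge> 1" using a0 by (auto simp: C_def intro!: sum_nonneg)
    have "a n \<le> C * K ^ n" for n
    proof (cases "n \<le> N")
      case True
      have "a n \<le> (\<Sum>n\<le>N. a n)" by (rule member_le_sum) (use True a0 in auto)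
      also have "\<dots> \<le> C * 1" by (simp add: C_def)
      also have "\<dots> \<le> C * K ^ n" using K C by (intro mult_left_mono one_le_power) auto
      finally show ?thesis .
    next
      case False
      then have "root n (a n) \<le> K" using N[of n] by (simp add: K_def)
      then have "root n (a n) ^ n \<le> K ^ n" using a0 by (intro power_mono real_root_ge_zero) auto
      then have "1 * a n \<le> C * K ^ n" using False a0 C K by (intro mult_mono) auto
      then show ?thesis by simp
    qed
    then show "\<exists>C\<ge>0. \<exists>K\<ge>0. \<forall>n. a n \<le> C * K ^ n" using C K by (meson order_trans zero_le_one)
  next
    assume "\<exists>C\<ge>0. \<exists>K\<ge>0. \<forall>n. a n \<le> C * K ^ n"
    then obtain C K where CK: "C \<ge> 0" "K \<ge> 0" "\<And>n. a n \<le> C * K ^ n" by blast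
    have "\<forall>\<^sub>F n in sequentially. ereal (root n (a n)) \<le> ereal ((1 + C) * K)"
      using eventually_gt_at_top[of 0]
    proof eventually_elim
      case (elim n)
      \<comment> \<open>This absorbs the constant into the base of the power, so the
        \<open>n\<close>-th root of \<open>C\<close> need not be shown to tend to 1.\<close>
      have "C \<le> (1 + C) ^ n" using CK(1) self_le_power[of "1 + C" n] elim by auto
      then have "C * K ^ n \<le> ((1 + C) * K) ^ n"
        using CK by (auto simp: power_mult_distrib intro!: mult_right_mono)
      then have "root n (a n) \<le> root n (((1 + C) * K) ^ n)"
        using CK(3)[of n] elim by (intro real_root_le_mono) auto
      then show ?case using elim CK by (simp add: real_root_power_cancel)
    qed
    then have "taylor_growth f \<alpha> \<le> ereal ((1 + C) * K)" unfolding eq by (rule Limsup_bounded)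
    then show "taylor_growth f \<alpha> < \<infinity>" by (rule order.strict_trans1) simp
  qed
  then have "taylor_growth f \<alpha> = \<infinity> \<longleftrightarrow> \<not> (\<exists>C\<ge>0. \<exists>K\<ge>0. \<forall>n. a n \<le> C * K ^ n)"
    by (metis less_ereal.simps(4) linorder_neq_iff ereal_infty_less(1))
  then show ?thesis unfolding a_iff[symmetric] by (meson not_le)
qed


section \<open>Gamma densities\<close>

definition gamma_density :: "real \<Rightarrow> nat \<Rightarrow> real \<Rightarrow> complex" where
  "gamma_density s m t = of_real (s ^ Suc m * (t ^ m * exp (- s * t)) / fact m)"

text \<open>The derivative of the density with exponent m is s times the difference of those with
  exponents m - 1 and m, the former read as 0 when m = 0. All derivatives thus stay in the span of
  gamma densities with the same rate.\<close>

primrec gamma_density_deriv :: "real \<Rightarrow> nat \<Rightarrow> nat \<Rightarrow> real \<Rightarrow> complex" where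
  "gamma_density_deriv s 0 = gamma_density s"
| "gamma_density_deriv s (Suc k) = (\<lambda>m t. of_real s *
     ((if m = 0 then 0 else gamma_density_deriv s k (m - 1) t) - gamma_density_deriv s k m t))"

lemma has_vector_derivative_gamma_density_deriv:
  "(gamma_density_deriv s k m has_vector_derivative gamma_density_deriv s (Suc k) m t) (at t within S)"
proof (induction k arbitrary: m)
  case 0
  have *: "((\<lambda>t. s ^ Suc m * (t ^ m * exp (- s * t)) / fact m) has_real_derivative
      s * ((if m = 0 then 0 else s ^ m * (t ^ (m - 1) * exp (- s * t)) / fact (m - 1))
        - s ^ Suc m * (t ^ m * exp (- s * t)) / fact m)) (at t within S)"
  proof (cases m)
    case 0
    then show ?thesis by (auto intro!: derivative_eq_intros)
  next
    case (Suc j)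
    have p: "((\<lambda>t. t ^ Suc j) has_real_derivative real (Suc j) * t ^ j) (at t within S)"
      using DERIV_pow[of "Suc j" t S] by simp
    have e: "((\<lambda>t. exp (- s * t)) has_real_derivative exp (- s * t) * - s) (at t within S)"
      by (auto intro!: derivative_eq_intros)
    show ?thesis unfolding Suc
      by (rule DERIV_cong[OF DERIV_cdivide[OF DERIV_cmult[OF DERIV_mult[OF p e]]]])
        (simp add: field_simps del: of_nat_Suc)
  qed
  have "gamma_density_deriv s (Suc 0) m t =
      of_real (s * ((if m = 0 then 0 else s ^ m * (t ^ (m - 1) * exp (- s * t)) / fact (m - 1))
        - s ^ Suc m * (t ^ m * exp (- s * t)) / fact m))"
    by (cases m) (simp_all add: gamma_density_def del: of_nat_Suc fact_Suc)
  moreover have "gamma_density_deriv s 0 m =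
      (\<lambda>t. of_real (s ^ Suc m * (t ^ m * exp (- s * t)) / fact m))"
    by (simp add: gamma_density_def fun_eq_iff)
  ultimately show ?case
    using has_vector_derivative_of_real[OF *]
    by (simp only:)
next
  case (Suc k)
  have "((\<lambda>t. if m = 0 then 0 else gamma_density_deriv s k (m - 1) t) has_vector_derivative
      (if m = 0 then 0 else gamma_density_deriv s (Suc k) (m - 1) t)) (at t within S)"
    using Suc.IH[of "m - 1"] by (cases "m = 0") (simp_all del: gamma_density_deriv.simps)
  note X = has_vector_derivative_mult_right[OF has_vector_derivative_diff[OF this Suc.IH[of m]], of "of_real s"]
  have A: "gamma_density_deriv s (Suc k) m = (\<lambda>t. of_real s *
      ((if m = 0 then 0 else gamma_density_deriv s k (m - 1) t) - gamma_density_deriv s k m t))"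
    by (rule ext) (simp only: gamma_density_deriv.simps)
  have B: "gamma_density_deriv s (Suc (Suc k)) m t = of_real s *
      ((if m = 0 then 0 else gamma_density_deriv s (Suc k) (m - 1) t) - gamma_density_deriv s (Suc k) m t)"
    by (rule gamma_density_deriv.simps(2)[THEN fun_cong, THEN fun_cong])
  show ?case by (subst A, subst B, rule X)
qed

text \<open>Each differentiation contributes a factor \<open>s\<close> and doubles the number of
  terms, while exponents never increase; a common bound for all \<open>p \<le> m\<close> is
  therefore enough.\<close>

lemma gamma_density_deriv_bound:
  assumes "s \<ge> 0" "w \<ge> 0" and B: "\<And>p. p \<le> m \<Longrightarrow> w * cmod (gamma_density s p t) \<le> B"
  shows "w * cmod (gamma_density_deriv s k m t) \<le> (2 * s) ^ k * B"
  using B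
proof (induction k arbitrary: m)
  case 0
  then show ?case by simp
next
  case (Suc k)
  define u where "u = (if m = 0 then 0 else gamma_density_deriv s k (m - 1) t)"
  define v where "v = gamma_density_deriv s k m t"
  have v: "w * cmod v \<le> (2 * s) ^ k * B" unfolding v_def by (rule Suc.IH[OF Suc.prems])
  have "0 \<le> B" using order_trans[OF _ Suc.prems[of 0]] assms(2) by simp
  then have u: "w * cmod u \<le> (2 * s) ^ k * B"
    using Suc.IH[of "m - 1"] Suc.prems assms(1) by (auto simp: u_def)
  have "w * cmod (gamma_density_deriv s (Suc k) m t) = s * (w * cmod (u - v))"
    using assms(1) by (simp add: u_def v_def norm_mult)
  also have "\<dots> \<le> s * (w * (cmod u + cmod v))"
    using assms by (intro mult_left_mono norm_triangle_ineq4) auto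
  also have "\<dots> \<le> s * ((2 * s) ^ k * B + (2 * s) ^ k * B)"
    using add_mono[OF u v] assms(1) by (intro mult_left_mono) (simp_all only: distrib_left)
  finally show ?case by (simp add: mult_ac)
qed

lemma fact_add_le: "fact (p + l) \<le> (fact p * real (p + l) ^ l :: real)"
proof (induction l)
  case (Suc l)
  have "fact (p + Suc l) = real (p + Suc l) * fact (p + l)" by simp
  also have "\<dots> \<le> real (p + Suc l) * (fact p * real (p + l) ^ l)"
    by (intro mult_left_mono Suc.IH) auto
  also have "\<dots> \<le> real (p + Suc l) * (fact p * real (p + Suc l) ^ l)"
    by (intro mult_left_mono power_mono) auto
  finally show ?case by simp
qed simp

lemma fact_add_ge: "fact p * real p ^ l \<le> (fact (p + l) :: real)"
proof (induction l)
  case (Suc l)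
  have "fact p * real p ^ Suc l = real p * (fact p * real p ^ l)" by simp
  also have "\<dots> \<le> real (p + Suc l) * fact (p + l)"
    by (intro mult_mono Suc.IH) auto
  finally show ?case by simp
qed simp

lemma power_mult_gamma_density_le:
  assumes "s > 0" "t \<ge> 0"
  shows "t ^ l * cmod (gamma_density s p t) \<le> s * (real (p + l) / s) ^ l"
proof -
  have "t ^ l * cmod (gamma_density s p t) = s ^ Suc p * (t ^ (p + l) * exp (- s * t)) / fact p"
    using assms by (simp add: gamma_density_def norm_mult norm_divide norm_power power_add mult_ac del: power_Suc)
  also have "\<dots> \<le> s ^ Suc p * (fact (p + l) / s ^ (p + l)) / fact p"
    using assms by (intro divide_right_mono mult_left_mono power_mult_exp_minus_le) auto
  also have "\<dots> \<le> s ^ Suc p * ((fact p * real (p + l) ^ l) / s ^ (p + l)) / fact p"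
    using assms by (intro divide_right_mono mult_left_mono fact_add_le) auto
  also have "\<dots> = s * (real (p + l) / s) ^ l"
    using assms by (simp add: power_add power_divide)
  finally show ?thesis .
qed

lemma shifted_power_le: "t \<ge> 0 \<Longrightarrow> (1 + t) ^ l \<le> 2 ^ l * (1 + t ^ l)" for t :: real
proof -
  assume t: "t \<ge> 0"
  have "(1 + t) ^ l \<le> (2 * max 1 t) ^ l" using t by (intro power_mono) auto
  also have "\<dots> = 2 ^ l * max 1 t ^ l" by (simp add: power_mult_distrib)
  also have "max 1 t ^ l \<le> 1 + t ^ l" using t by (auto simp: max_def)
  finally show ?thesis by simp
qed

text \<open>The condition \<open>real m \<le> s\<^sup>2\<close> keeps the mass at t of order
  \<open>s\<close>. The power of \<open>s\<close> collects one factor from the height,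
  \<open>l\<close> from the weight and \<open>l\<close> from differentiation. Polynomial growth in
  \<open>s\<close> suffices, because \<open>bump\<close> carries an exponential weight.\<close>

lemma gamma_density_weight_le:
  assumes s: "s \<ge> 1" and t: "t \<ge> 0" and "k \<le> l" and m: "real m \<le> s\<^sup>2"
  shows "(1 + t) ^ l * cmod (gamma_density_deriv s k m t) \<le> 2 * 4 ^ l * (1 + real l) ^ l * s ^ (2 * l + 1)"
proof -
  have *: "(1 + t) ^ l * cmod (gamma_density s p t) \<le> 2 ^ l * (2 * s * (s * (1 + real l)) ^ l)" if "p \<le> m" for p
  proof -
    have "(1 + t) ^ l * cmod (gamma_density s p t) \<le> (2 ^ l * (1 + t ^ l)) * cmod (gamma_density s p t)"
      by (intro mult_right_mono shifted_power_le t) auto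
    also have "\<dots> = 2 ^ l * (t ^ 0 * cmod (gamma_density s p t) + t ^ l * cmod (gamma_density s p t))"
      by (simp add: algebra_simps)
    also have "\<dots> \<le> 2 ^ l * (s * (real (p + 0) / s) ^ 0 + s * (real (p + l) / s) ^ l)"
      using s t by (intro mult_left_mono add_mono power_mult_gamma_density_le) auto
    also have "\<dots> \<le> 2 ^ l * (s * (s * (1 + real l)) ^ l + s * (s * (1 + real l)) ^ l)"
    proof (intro mult_left_mono add_mono power_mono)
      have s1: "1 \<le> s * (1 + real l)" using mult_mono[of 1 s 1 "1 + real l"] s by simp
      then show "(real (p + 0) / s) ^ 0 \<le> (s * (1 + real l)) ^ l" by simp
      have "real (p + l) \<le> s\<^sup>2 + s\<^sup>2 * real l"
        using that m mult_right_mono[of 1 "s\<^sup>2" "real l"] s by simp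
      then show "real (p + l) / s \<le> s * (1 + real l)"
        using s by (simp add: field_simps power2_eq_square)
    qed (use s in auto)
    finally show ?thesis by (simp add: mult_ac)
  qed
  have "(1 + t) ^ l * cmod (gamma_density_deriv s k m t) \<le> (2 * s) ^ k * (2 ^ l * (2 * s * (s * (1 + real l)) ^ l))"
    by (rule gamma_density_deriv_bound) (use s t * in auto)
  also have "\<dots> \<le> (2 * s) ^ l * (2 ^ l * (2 * s * (s * (1 + real l)) ^ l))"
    using s \<open>k \<le> l\<close> by (intro mult_right_mono power_increasing) auto
  also have "\<dots> = 2 * 4 ^ l * (1 + real l) ^ l * s ^ (2 * l + 1)"
  proof -
    have "(4::real) ^ l = 2 ^ l * 2 ^ l" "s ^ (2 * l + 1) = s ^ l * s ^ l * s"
      by (simp_all add: power_add mult_2 flip: power_mult_distrib)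
    then show ?thesis by (simp only: power_mult_distrib mult_ac)
  qed
  finally show ?thesis .
qed

section \<open>The humps and two-sided bounds for their moments\<close>

text \<open>The density has mean about \<open>n\<^sup>2\<close> and standard deviation about \<open>1\<close>.  The factor
  \<open>exp (- n)\<close> decays faster than any power of \<open>n\<close>, but the \<open>n\<close>-th moment, about \<open>n ^ (2 * n) * exp (- n)\<close>,
  still exceeds \<open>fact n * K ^ n\<close> eventually, for every \<open>K\<close>.\<close>

definition bump :: "nat \<Rightarrow> real \<Rightarrow> complex" where
  "bump n t = (if t < 0 then 0 else of_real (exp (- real n)) * gamma_density ((real n)\<^sup>2) (n ^ 4) t)"

lemma
  assumes "n > 0"
  shows bump_in_schwartz: "bump n \<in> schwartz_halfline"
    and schwartz_norm_bump_le: "schwartz_norm l (bump n) \<le>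
      ereal (2 * 4 ^ l * (1 + real l) ^ l * (real n ^ (4 * l + 2) / exp (real n)))"
proof -
  define F where "F k t = of_real (exp (- real n)) * gamma_density_deriv ((real n)\<^sup>2) k (n ^ 4) t" for k t
  have F: "deriv_chain F"
    unfolding deriv_chain_def F_def
    by (intro allI impI has_vector_derivative_mult_right has_vector_derivative_gamma_density_deriv)
  have F0: "\<forall>t\<ge>0. bump n t = F 0 t" by (simp add: bump_def F_def)
  have b: "(1 + t) ^ l * cmod (F k t) \<le> 2 * 4 ^ l * (1 + real l) ^ l * (real n ^ (4 * l + 2) / exp (real n))"
    if "k \<le> l" "t \<ge> 0" for l k t
  proof -
    have "(real n)\<^sup>2 \<ge> 1" using assms by (simp add: one_le_power)
    then have *: "(1 + t) ^ l * cmod (gamma_density_deriv ((real n)\<^sup>2) k (n ^ 4) t)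
        \<le> 2 * 4 ^ l * (1 + real l) ^ l * ((real n)\<^sup>2) ^ (2 * l + 1)"
      using that by (intro gamma_density_weight_le) auto
    have "(1 + t) ^ l * cmod (F k t)
        = exp (- real n) * ((1 + t) ^ l * cmod (gamma_density_deriv ((real n)\<^sup>2) k (n ^ 4) t))"
      by (simp add: F_def norm_mult)
    also have "\<dots> \<le> exp (- real n) * (2 * 4 ^ l * (1 + real l) ^ l * ((real n)\<^sup>2) ^ (2 * l + 1))"
      by (intro mult_left_mono *) auto
    also have "((real n)\<^sup>2) ^ (2 * l + 1) = real n ^ (4 * l + 2)"
    proof -
      have "2 * (2 * l + 1) = 4 * l + 2" by simp
      then show ?thesis by (metis power_mult)
    qed
    finally show ?thesis by (simp add: exp_minus field_simps)
  qed
  show "bump n \<in> schwartz_halfline"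
    by (rule schwartz_halflineI[OF _ F F0]) (use b in \<open>auto simp: bump_def\<close>)
  show "schwartz_norm l (bump n) \<le> ereal (2 * 4 ^ l * (1 + real l) ^ l * (real n ^ (4 * l + 2) / exp (real n)))"
    using b by (simp add: schwartz_norm_le_iff higher_vderiv_eq_chain[OF F F0])
qed

lemma eventually_schwartz_norm_bump_le:
  assumes "e > 0"
  shows "\<forall>\<^sub>F n in sequentially. schwartz_norm l (bump n) \<le> ereal e"
proof -
  have "(\<lambda>n. real n ^ (4 * l + 2) / exp (real n)) \<longlonglongrightarrow> 0"
    using filterlim_compose[OF tendsto_power_div_exp_0 filterlim_real_sequentially] .
  then have "(\<lambda>n. 2 * 4 ^ l * (1 + real l) ^ l * (real n ^ (4 * l + 2) / exp (real n))) \<longlonglongrightarrow> 0"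
    by (rule tendsto_mult_right_zero)
  then have "\<forall>\<^sub>F n in sequentially. 2 * 4 ^ l * (1 + real l) ^ l * (real n ^ (4 * l + 2) / exp (real n)) < e"
    using assms by (rule order_tendstoD(2))
  with eventually_gt_at_top[of 0] show ?thesis
  proof eventually_elim
    case (elim n)
    from schwartz_norm_bump_le[OF elim(1), of l] show ?case
      by (rule order_trans) (use elim in simp)
  qed
qed

text \<open>The twist moves the rate from n^2 to n^2 + ix, and the power of t moves the exponent
  from n^4 to k + n^4, so Euler's integral evaluates the moment.\<close>

lemma cmod_moment_bump:
  assumes "n > 0"
  shows "cmod (moment k (bump n) x) = exp (- real n) * ((real n)\<^sup>2) ^ Suc (n ^ 4) * fact (k + n ^ 4) / fact (n ^ 4)
    / cmod (of_real ((real n)\<^sup>2) + \<i> * of_real x) ^ Suc (k + n ^ 4)"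
proof -
  define s where "s = (real n)\<^sup>2"
  define m where "m = n ^ 4"
  define z where "z = of_real s + \<i> * complex_of_real x"
  define c where "c = complex_of_real (exp (- real n) * s ^ Suc m / fact m) * (- \<i>) ^ k"
  have "Re z > 0" using assms by (simp add: z_def s_def)
  have "moment k (bump n) x = (LINT t:{0..}|lborel. c * (of_real t ^ (k + m) * exp (- z * of_real t)))"
    unfolding moment_def
  proof (rule set_lebesgue_integral_cong)
    show "\<forall>t. t \<in> {0..} \<longrightarrow>
        exp (- (\<i> * complex_of_real x * complex_of_real t)) * (- (\<i> * complex_of_real t)) ^ k * bump n t
        = c * (of_real t ^ (k + m) * exp (- z * of_real t))"
    proof (intro allI impI)
      fix t :: real assume t: "t \<in> {0..}"
      have "exp (- z * of_real t) = exp (- (\<i> * complex_of_real x * complex_of_real t)) * of_real (exp (- s * t))"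
        by (simp add: z_def algebra_simps exp_of_real[symmetric] flip: exp_add)
      moreover have "(- (\<i> * complex_of_real t)) ^ k = (- \<i>) ^ k * of_real t ^ k"
        by (simp flip: power_mult_distrib)
      ultimately show "exp (- (\<i> * complex_of_real x * complex_of_real t)) * (- (\<i> * complex_of_real t)) ^ k * bump n t
        = c * (of_real t ^ (k + m) * exp (- z * of_real t))"
        using t by (simp add: bump_def gamma_density_def c_def power_add mult_ac flip: s_def m_def)
    qed
  qed simp
  also have "\<dots> = c * (fact (k + m) / z ^ Suc (k + m))"
    using integral_power_mult_exp[OF \<open>Re z > 0\<close>, of "k + m"] by simp
  also have "cmod \<dots> = exp (- real n) * s ^ Suc m * fact (k + m) / fact m / cmod z ^ Suc (k + m)"
    by (simp add: c_def norm_mult norm_divide norm_power s_def del: power_Suc)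
  finally show ?thesis unfolding z_def s_def m_def .
qed

text \<open>The quotient (k+m)! / m! is k! times a binomial coefficient, which is at most 2^(k+m).
  This serves for humps placed before the order under study, where n^4 <= k.\<close>

lemma cmod_moment_bump_le:
  assumes "n > 0"
  shows "cmod (moment k (bump n) x) \<le> fact k * 2 ^ (k + n ^ 4)"
proof -
  define s where "s = (real n)\<^sup>2"
  define m where "m = n ^ 4"
  define z where "z = of_real s + \<i> * complex_of_real x"
  have s: "s \<ge> 1" using assms by (simp add: s_def one_le_power)
  have "s \<le> cmod z" using complex_Re_le_cmod[of z] by (simp add: z_def)
  have "cmod (moment k (bump n) x) = exp (- real n) * s ^ Suc m * fact (k + m) / fact m / cmod z ^ Suc (k + m)"
    using cmod_moment_bump[OF assms, of k x] by (simp only: s_def m_def z_def)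
  \<comment> \<open>Raising the exponent of \<open>s\<close> gives away a factor
    \<open>s ^ k\<close>, so that the powers cancel after \<open>cmod z\<close> is replaced by its
    lower bound \<open>s\<close>.\<close>
  also have "\<dots> \<le> 1 * s ^ Suc (k + m) * fact (k + m) / fact m / s ^ Suc (k + m)"
    using s \<open>s \<le> cmod z\<close> by (intro frac_le divide_right_mono mult_right_mono mult_mono power_increasing power_mono) auto
  also have "\<dots> = fact (k + m) / fact m" using s by simp
  also have "\<dots> = fact k * real ((k + m) choose k)"
    using binomial_fact[of k "k + m", where ?'a = real] by simp
  also have "\<dots> \<le> fact k * 2 ^ (k + m)"
    using binomial_le_pow2 by (intro mult_left_mono) (auto simp: of_nat_power[symmetric] simp del: of_nat_power)
  finally show ?thesis by (simp add: m_def)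
qed

text \<open>By 1 + u <= exp(u), |z| is at most s exp(x^2 / (2 s^2)). The exponent n + m + 1 is of
  order s^2, so the total loss is exp(2 x^2), independent of \<open>n\<close>. Then (n+m)! / m! >=
  m^n = s^(2n) leaves exp(-n) s^n with s = n^2.\<close>

lemma cmod_moment_bump_ge:
  assumes "n > 0"
  shows "exp (- (2 * x\<^sup>2)) * (fact n * (real n / exp 1) ^ n) \<le> cmod (moment n (bump n) x)"
proof -
  define s where "s = (real n)\<^sup>2"
  define m where "m = n ^ 4"
  define z where "z = of_real s + \<i> * complex_of_real x"
  have s: "s \<ge> 1" using assms by (simp add: s_def one_le_power)
  have ms: "real m = s\<^sup>2" by (simp add: m_def s_def flip: power_mult)
  have "(cmod z)\<^sup>2 = s\<^sup>2 + x\<^sup>2" by (simp add: z_def cmod_power2)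
  also have "\<dots> = s\<^sup>2 * (1 + x\<^sup>2 / s\<^sup>2)" using s by (simp add: field_simps)
  also have "\<dots> \<le> s\<^sup>2 * exp (x\<^sup>2 / s\<^sup>2)" by (intro mult_left_mono exp_ge_add_one_self) auto
  also have "\<dots> = (s * exp (x\<^sup>2 / s\<^sup>2 / 2))\<^sup>2"
    by (simp add: power_mult_distrib flip: exp_double)
  finally have "cmod z \<le> s * exp (x\<^sup>2 / s\<^sup>2 / 2)"
    by (rule power2_le_imp_le) (use s in auto)
  then have "cmod z ^ Suc (n + m) \<le> (s * exp (x\<^sup>2 / s\<^sup>2 / 2)) ^ Suc (n + m)"
    by (intro power_mono) auto
  also have "\<dots> = s ^ Suc (n + m) * exp (real (Suc (n + m)) * (x\<^sup>2 / s\<^sup>2 / 2))"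
    by (simp only: power_mult_distrib exp_of_nat_mult)
  also have "\<dots> \<le> s ^ Suc (n + m) * exp (2 * x\<^sup>2)"
  proof -
    have "n \<le> m" "1 \<le> m" using assms self_le_power[of n 4] by (auto simp: m_def)
    \<comment> \<open>Even n + m + 1 <= 3 m holds; the factor 4, halved by the square root, becomes
      the 2 in exp(2 x^2).\<close>
    then have "real (Suc (n + m)) \<le> 4 * s\<^sup>2" unfolding ms[symmetric] by linarith
    then have "real (Suc (n + m)) * (x\<^sup>2 / s\<^sup>2 / 2) \<le> 4 * s\<^sup>2 * (x\<^sup>2 / s\<^sup>2 / 2)"
      by (intro mult_right_mono) auto
    also have "\<dots> = 2 * x\<^sup>2" using s by simp
    finally show ?thesis using s by (intro mult_left_mono) auto
  qed
  finally have z: "cmod z ^ Suc (n + m) \<le> s ^ Suc (n + m) * exp (2 * x\<^sup>2)" .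
  \<comment> \<open>Of the two factors n^n in s^n, one is given up to n!; the other joins exp(-n) to
    form (n/e)^n, which beats every geometric sequence.\<close>
  have "exp (- (2 * x\<^sup>2)) * (fact n * (real n / exp 1) ^ n)
      \<le> exp (- (2 * x\<^sup>2)) * (real n ^ n * (real n / exp 1) ^ n)"
    using fact_le_power[of n, where ?'a = real] by (intro mult_left_mono mult_right_mono) auto
  also have "\<dots> = exp (- (2 * x\<^sup>2)) * exp (- real n) * s ^ n"
  proof -
    have "exp (- real n) = 1 / exp 1 ^ n"
      using exp_of_nat_mult[of n "1::real"] by (simp add: exp_minus divide_inverse)
    then show ?thesis by (simp add: s_def power_divide power2_eq_square power_mult_distrib)
  qed
  also have "\<dots> = exp (- real n) * s ^ Suc m * (fact m * real m ^ n) / fact m / (s ^ Suc (n + m) * exp (2 * x\<^sup>2))"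
  proof -
    have eqs: "s ^ Suc (n + m) = s ^ n * s ^ Suc m" "real m ^ n = s ^ n * s ^ n"
      by (simp_all add: ms power_add power2_eq_square power_mult_distrib)
    have X: "exp (- a) * exp (- b) * v = exp (- b) * u * (c * (v * v)) / c / (v * u * exp a)"
      if "u \<noteq> 0" "v \<noteq> 0" "c \<noteq> 0" for a b u v c :: real
      using that by (simp add: exp_minus field_simps)
    show ?thesis unfolding eqs by (rule X) (use s in auto)
  qed
  also have "\<dots> \<le> exp (- real n) * s ^ Suc m * fact (n + m) / fact m / cmod z ^ Suc (n + m)"
  proof (intro frac_le divide_right_mono mult_left_mono)
    show "fact m * real m ^ n \<le> fact (n + m)" using fact_add_ge[of m n] by (simp add: add.commute)
    have "z \<noteq> 0" using s by (auto simp: z_def complex_eq_iff)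
    then show "0 < cmod z ^ Suc (n + m)" by simp
  qed (use s z in auto)
  also have "\<dots> = cmod (moment n (bump n) x)"
    using cmod_moment_bump[OF assms, of n x] by (simp only: s_def m_def z_def)
  finally show ?thesis .
qed


section \<open>A function with divergent Taylor series everywhere\<close>

text \<open>The tail of the series is again a Schwartz function, so linearity for two summands
  suffices and the infinite sum is never interchanged with the integral.\<close>

lemma moment_suminf_split:
  assumes \<psi>: "\<And>i. \<psi> i \<in> schwartz_halfline"
    and sN: "\<And>l. summable (N l)"
    and N: "\<And>l i. schwartz_norm l (\<psi> i) \<le> ereal (N l i)"
  shows "moment n (\<lambda>t. \<Sum>i. \<psi> i t) x =
    (\<Sum>i<j. moment n (\<psi> i) x) + moment n (\<lambda>t. \<Sum>i. \<psi> (i + j) t) x"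
proof (induction j)
  case (Suc j)
  have sN': "summable (\<lambda>i. N l (i + j))" for l j
    using sN by (simp add: summable_iff_shift)
  note S = schwartz_norm_suminf[where M = "\<lambda>l i. N l (i + j)" for j, OF \<psi> sN' N]
  have "moment n (\<lambda>t. \<Sum>i. \<psi> (i + j) t) x = moment n (\<lambda>t. \<psi> j t + 1 * (\<Sum>i. \<psi> (i + Suc j) t)) x"
    unfolding moment_def
  proof (rule set_lebesgue_integral_cong, simp, intro allI impI)
    fix t :: real assume "t \<in> {0..}"
    then have "(\<Sum>i. \<psi> (i + j) t) = \<psi> j t + 1 * (\<Sum>i. \<psi> (i + Suc j) t)"
      using suminf_split_head[OF S(3)[of t j]] by simp
    then show "exp (- (\<i> * complex_of_real x * complex_of_real t)) * (- (\<i> * complex_of_real t)) ^ n * (\<Sum>i. \<psi> (i + j) t)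
      = exp (- (\<i> * complex_of_real x * complex_of_real t)) * (- (\<i> * complex_of_real t)) ^ n * (\<psi> j t + 1 * (\<Sum>i. \<psi> (i + Suc j) t))"
      by simp
  qed
  also have "\<dots> = moment n (\<psi> j) x + moment n (\<lambda>t. \<Sum>i. \<psi> (i + Suc j) t) x"
    using moment_lincomb[OF \<psi> S(1)[of "Suc j"], of n j 1 x] by simp
  finally show ?case using Suc.IH by simp
qed simp

text \<open>The fourth-power condition makes earlier humps geometrically bounded at the current
  order. The seminorm condition, with index \<open>\<sigma> i + 2\<close>, makes later humps
  harmless for the moment of order \<open>\<sigma> i\<close>.\<close>

lemma exists_sparse_bumps:
  obtains \<sigma> :: "nat \<Rightarrow> nat" where "strict_mono \<sigma>" "\<And>i. \<sigma> i > 0" "\<And>i. \<sigma> i ^ 4 \<le> \<sigma> (Suc i)"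
    "\<And>i. schwartz_norm (\<sigma> i + 2) (bump (\<sigma> (Suc i))) \<le> ereal ((1 / 2) ^ \<sigma> i)"
proof -
  define Q where "Q n N \<longleftrightarrow> n < N \<and> n ^ 4 \<le> N \<and>
    schwartz_norm (n + 2) (bump N) \<le> ereal ((1 / 2) ^ n)" for n N
  have step: "\<exists>N. N > 0 \<and> Q n N" for n
  proof -
    have "\<forall>\<^sub>F N in sequentially. N > 0 \<and> Q n N" unfolding Q_def
      by (intro eventually_conj eventually_gt_at_top eventually_ge_at_top eventually_schwartz_norm_bump_le) simp
    then show ?thesis using eventually_happens'[OF sequentially_bot] by blast
  qed
  have "\<exists>\<sigma>. \<forall>i. \<sigma> i > 0 \<and> Q (\<sigma> i) (\<sigma> (Suc i))"
    by (rule dependent_nat_choice) (use step in auto)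
  then obtain \<sigma> where \<sigma>: "\<And>i. \<sigma> i > 0" "\<And>i. Q (\<sigma> i) (\<sigma> (Suc i))" by blast
  have "strict_mono \<sigma>" unfolding strict_mono_Suc_iff using \<sigma>(2) by (simp add: Q_def)
  then show thesis by (rule that) (use \<sigma> in \<open>simp_all add: Q_def\<close>)
qed

text \<open>The three terms on the left are the geometric bound to be violated, the contribution 8^n
  of earlier humps and the contribution 2 of later ones.\<close>

lemma eventually_superexponential:
  assumes "c > 0" "C \<ge> 0" "K \<ge> 0"
  shows "\<forall>\<^sub>F n in sequentially. C * K ^ n + 8 ^ n + 2 < c * (real n / exp 1) ^ n"
proof -
  \<comment> \<open>The base \<open>K + 8\<close> dominates all three terms. The summand
    \<open>c\<close> makes the quotient at least 1, so that it is at most its own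
    \<open>n\<close>-th power and can be absorbed into the base.\<close>
  define A where "A = (C + 4 + c) / c * (K + 8)"
  have c1: "(C + 4 + c) / c \<ge> 1" using assms by simp
  have "A \<ge> 0" unfolding A_def using assms by (intro mult_nonneg_nonneg divide_nonneg_pos) auto
  have "\<forall>\<^sub>F n in sequentially. real n \<ge> exp 1 * A"
    using filterlim_real_sequentially by (simp add: filterlim_at_top)
  with eventually_gt_at_top[of 0] show ?thesis
  proof eventually_elim
    case (elim n)
    have k: "K ^ n \<le> (K + 8) ^ n" "8 ^ n \<le> (K + 8) ^ n" "1 \<le> (K + 8) ^ n"
      using assms by (auto intro!: power_mono one_le_power)
    have "C * K ^ n + 8 ^ n + 2 < (C + 4) * (K + 8) ^ n"
      using k mult_left_mono[OF k(1) assms(2)] unfolding distrib_right by linarith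
    also have "\<dots> \<le> (C + 4 + c) * (K + 8) ^ n"
      using assms by (intro mult_right_mono) auto
    also have "\<dots> = c * ((C + 4 + c) / c * (K + 8) ^ n)" using assms by simp
    also have "\<dots> \<le> c * (((C + 4 + c) / c) ^ n * (K + 8) ^ n)"
      using assms c1 elim(1) by (intro mult_left_mono mult_right_mono self_le_power) auto
    also have "\<dots> = c * A ^ n" by (simp only: A_def power_mult_distrib)
    also have "\<dots> \<le> c * (real n / exp 1) ^ n"
      using elim(2) assms \<open>A \<ge> 0\<close> by (intro mult_left_mono power_mono) (auto simp: field_simps)
    finally show ?case .
  qed
qed

text \<open>At order n = \<open>\<sigma> (Suc j)\<close> the term \<open>\<psi> j\<close> has a
  moment of at least n! exp(-2 x^2) (n/e)^n, the earlier terms contribute at most n! 8^n and the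
  later ones at most 2.\<close>

lemma exists_divergent_taylor:
  obtains h where "h \<in> schwartz_halfline" "\<And>\<alpha>. taylor_growth h \<alpha> = \<infinity>"
proof -
  obtain \<sigma> :: "nat \<Rightarrow> nat" where \<sigma>: "strict_mono \<sigma>" "\<And>i. \<sigma> i > 0" "\<And>i. \<sigma> i ^ 4 \<le> \<sigma> (Suc i)"
    "\<And>i. schwartz_norm (\<sigma> i + 2) (bump (\<sigma> (Suc i))) \<le> ereal ((1 / 2) ^ \<sigma> i)"
    using exists_sparse_bumps by blast
  \<comment> \<open>The shift by one matches the sparseness conditions, which bound the hump at
    \<open>\<sigma> (Suc i)\<close> in terms of \<open>\<sigma> i\<close>.\<close>
  define \<psi> where "\<psi> i = bump (\<sigma> (Suc i))" for i
  have \<psi>: "\<psi> i \<in> schwartz_halfline" for i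
    unfolding \<psi>_def by (rule bump_in_schwartz[OF \<sigma>(2)])
  define N where "N l i = real_of_ereal (schwartz_norm l (\<psi> i))" for l i
  have N: "schwartz_norm l (\<psi> i) = ereal (N l i)" "N l i \<ge> 0" for l i
    using schwartz_norm_boundE[OF \<psi>[of i], of l] unfolding N_def by (metis real_of_ereal.simps(1))+
  have \<sigma>_ge: "i \<le> \<sigma> i" for i by (rule strict_mono_imp_increasing[OF \<sigma>(1)])
  \<comment> \<open>For fixed \<open>l\<close> this covers all but finitely many \<open>i\<close>,
    because \<open>\<sigma> i \<ge> i\<close>; that is enough for summability.\<close>
  have N_le: "N l i \<le> (1 / 2) ^ i" if "l \<le> \<sigma> i + 2" for l i
  proof -
    have "ereal (N l i) \<le> schwartz_norm (\<sigma> i + 2) (\<psi> i)"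
      unfolding N(1)[symmetric] by (rule schwartz_norm_mono[OF that])
    also have "\<dots> \<le> ereal ((1 / 2) ^ \<sigma> i)" unfolding \<psi>_def by (rule \<sigma>(4))
    finally show ?thesis
      using power_decreasing[OF \<sigma>_ge[of i], of "1 / 2 :: real"] by (auto intro: order_trans)
  qed
  have sN: "summable (N l)" for l
  proof (rule summable_comparison_test')
    show "summable (\<lambda>i. (1 / 2 :: real) ^ i)" by (rule summable_geometric) simp
    show "norm (N l i) \<le> (1 / 2) ^ i" if "i \<ge> l" for i
      using N_le[of l i] N(2) \<sigma>_ge[of i] that by simp
  qed
  have N': "schwartz_norm l (\<psi> i) \<le> ereal (N l i)" for l i by (simp add: N(1))
  define h where "h t = (\<Sum>i. \<psi> i t)" for t
  have h: "h \<in> schwartz_halfline"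
    unfolding h_def by (rule schwartz_norm_suminf(1)[OF \<psi> sN N'])
  have lower: "fact n * (exp (- (2 * x\<^sup>2)) * (real n / exp 1) ^ n - 8 ^ n - 2) \<le> cmod (moment n h x)"
    if n: "n = \<sigma> (Suc j)" for n j x
  proof -
    define P where "P = (\<Sum>i<j. moment n (\<psi> i) x)"
    define T where "T = moment n (\<lambda>t. \<Sum>i. \<psi> (i + Suc j) t) x"
    have eq: "moment n h x = P + moment n (\<psi> j) x + T"
      using moment_suminf_split[of \<psi> N n x "Suc j", OF \<psi> sN N'] by (simp add: h_def[abs_def] P_def T_def)
    \<comment> \<open>For i < j the exponent of the hump is \<open>\<sigma> (Suc i) ^ 4\<close>, at
      most \<open>\<sigma> j ^ 4\<close> and hence at most \<open>n\<close>; this explains n +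
      n.\<close>
    have "cmod P \<le> (\<Sum>i<j. fact n * 2 ^ (n + n))"
      unfolding P_def
    proof (rule sum_norm_le)
      fix i assume "i \<in> {..<j}"
      then have "\<sigma> (Suc i) ^ 4 \<le> \<sigma> j ^ 4"
        using strict_mono_leD[OF \<sigma>(1), of "Suc i" j] by (intro power_mono) auto
      also have "\<dots> \<le> n" unfolding n by (rule \<sigma>(3))
      finally have "fact n * 2 ^ (n + \<sigma> (Suc i) ^ 4) \<le> (fact n * 2 ^ (n + n) :: real)"
        by (intro mult_left_mono power_increasing) auto
      then show "cmod (moment n (\<psi> i) x) \<le> fact n * 2 ^ (n + n)"
        unfolding \<psi>_def by (intro order_trans[OF cmod_moment_bump_le] \<sigma>(2))
    qed
    also have "\<dots> = fact n * (real j * (2 ^ n * 2 ^ n))" by (simp add: power_add)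
    \<comment> \<open>The number \<open>j\<close> of earlier terms is bounded crudely by 2^n, which
      turns 4^n into 8^n.\<close>
    also have "\<dots> \<le> fact n * (2 ^ n * (2 ^ n * 2 ^ n))"
    proof -
      have "j \<le> n" unfolding n using \<sigma>_ge[of "Suc j"] by simp
      then have "real j \<le> 2 ^ n" using of_nat_less_two_power[of n, where ?'a = real] by (simp add: order.trans less_imp_le)
      then show ?thesis by (intro mult_left_mono mult_right_mono) auto
    qed
    also have "(2 ^ n * (2 ^ n * 2 ^ n) :: real) = 8 ^ n" by (simp flip: power_mult_distrib)
    finally have P: "cmod P \<le> fact n * 8 ^ n" .
    have "cmod T \<le> (\<Sum>i. N (n + 2) (i + Suc j))"
    proof -
      have sN': "summable (\<lambda>i. N l (i + Suc j))" for l
        by (intro summable_ignore_initial_segment sN)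
      note S = schwartz_norm_suminf[where M = "\<lambda>l i. N l (i + Suc j)", OF \<psi> sN' N']
      show ?thesis unfolding T_def by (rule cmod_moment_le[OF S(1,2)])
    qed
    also have "\<dots> \<le> (\<Sum>i. (1 / 2) ^ i)"
    proof (rule suminf_le)
      show "N (n + 2) (i + Suc j) \<le> (1 / 2) ^ i" for i
      proof -
        have "n + 2 \<le> \<sigma> (i + Suc j) + 2"
          unfolding n using strict_mono_leD[OF \<sigma>(1), of "Suc j" "i + Suc j"] by simp
        then have "N (n + 2) (i + Suc j) \<le> (1 / 2) ^ (i + Suc j)" by (rule N_le)
        also have "\<dots> \<le> (1 / 2) ^ i" by (intro power_decreasing) auto
        finally show ?thesis .
      qed
      show "summable (\<lambda>i. N (n + 2) (i + Suc j))" by (intro summable_ignore_initial_segment sN)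
    qed (auto intro: summable_geometric)
    also have "\<dots> = (2::real)" by (subst suminf_geometric) auto
    also have "\<dots> \<le> fact n * 2" by simp
    finally have T: "cmod T \<le> fact n * 2" .
    have "fact n * (exp (- (2 * x\<^sup>2)) * (real n / exp 1) ^ n) \<le> cmod (moment n (\<psi> j) x)"
      using cmod_moment_bump_ge[OF \<sigma>(2), of x "Suc j"] unfolding \<psi>_def n by (simp add: mult_ac)
    moreover have "cmod (moment n (\<psi> j) x) \<le> cmod (moment n h x) + cmod P + cmod T"
    proof -
      have "moment n (\<psi> j) x = moment n h x - P - T" by (simp add: eq)
      then show ?thesis using norm_triangle_ineq4[of "moment n h x - P" T] norm_triangle_ineq4[of "moment n h x" P] by simp
    qed
    ultimately show ?thesis using P T by (simp add: right_diff_distrib)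
  qed
  have "taylor_growth h \<alpha> = \<infinity>" for \<alpha>
    unfolding taylor_growth_eq_infinity_iff[OF h]
  proof (intro allI impI)
    fix C K :: real assume CK: "C \<ge> 0" "K \<ge> 0"
    have "strict_mono (\<lambda>j. \<sigma> (Suc j))" using \<sigma>(1) by (simp add: strict_mono_def)
    then have "filterlim (\<lambda>j. \<sigma> (Suc j)) at_top sequentially" by (rule filterlim_subseq)
    moreover have "\<forall>\<^sub>F n in sequentially. C * K ^ n + 8 ^ n + 2 < exp (- (2 * \<alpha>\<^sup>2)) * (real n / exp 1) ^ n"
      by (rule eventually_superexponential) (use CK in auto)
    ultimately have "\<forall>\<^sub>F j in sequentially. C * K ^ \<sigma> (Suc j) + 8 ^ \<sigma> (Suc j) + 2
        < exp (- (2 * \<alpha>\<^sup>2)) * (real (\<sigma> (Suc j)) / exp 1) ^ \<sigma> (Suc j)"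
      by (rule eventually_compose_filterlim[rotated])
    then obtain n j where n: "n = \<sigma> (Suc j)"
      "C * K ^ n + 8 ^ n + 2 < exp (- (2 * \<alpha>\<^sup>2)) * (real n / exp 1) ^ n"
      using eventually_happens'[OF sequentially_bot] by blast
    then have "fact n * (C * K ^ n) < fact n * (exp (- (2 * \<alpha>\<^sup>2)) * (real n / exp 1) ^ n - 8 ^ n - 2)"
      by simp
    also have "\<dots> \<le> cmod (moment n h \<alpha>)" by (rule lower[OF n(1)])
    finally show "\<exists>n. C * (fact n * K ^ n) < cmod (moment n h \<alpha>)" by (auto simp: mult_ac)
  qed
  with h that show thesis by blast
qed

section \<open>Exponential damping\<close>

text \<open>The powers of \<open>d/dt - \<epsilon>\<close>, which is \<open>d/dt\<close> conjugated by \<open>exp (- \<epsilon> * t)\<close>, acting on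
  a chain of derivatives; working with them avoids the Leibniz formula.\<close>

primrec damped_deriv :: "real \<Rightarrow> (nat \<Rightarrow> real \<Rightarrow> complex) \<Rightarrow> nat \<Rightarrow> nat \<Rightarrow> real \<Rightarrow> complex" where
  "damped_deriv \<epsilon> F 0 = F"
| "damped_deriv \<epsilon> F (Suc k) = (\<lambda>j t. damped_deriv \<epsilon> F k (Suc j) t - of_real \<epsilon> * damped_deriv \<epsilon> F k j t)"

lemma deriv_chain_damped_deriv:
  assumes "deriv_chain F" shows "deriv_chain (damped_deriv \<epsilon> F k)"
proof (induction k)
  case (Suc k)
  show ?case
    unfolding deriv_chain_def damped_deriv.simps
    by (intro allI impI has_vector_derivative_diff has_vector_derivative_mult_right deriv_chainD[OF Suc.IH])
qed (simp add: assms)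

lemma deriv_chain_damped:
  assumes "deriv_chain F"
  shows "deriv_chain (\<lambda>k t. of_real (exp (- \<epsilon> * t)) * damped_deriv \<epsilon> F k 0 t)"
  unfolding deriv_chain_def
proof (intro allI impI)
  fix k and t :: real assume t: "t \<ge> 0"
  have "((\<lambda>t. complex_of_real (exp (- \<epsilon> * t))) has_vector_derivative of_real (exp (- \<epsilon> * t) * - \<epsilon>)) (at t within {0..})"
    by (rule has_vector_derivative_of_real) (auto intro!: derivative_eq_intros)
  from has_vector_derivative_mult[OF this deriv_chainD[OF deriv_chain_damped_deriv[OF assms, of \<epsilon> k] t, of 0]]
  show "((\<lambda>t. of_real (exp (- \<epsilon> * t)) * damped_deriv \<epsilon> F k 0 t) has_vector_derivative
      of_real (exp (- \<epsilon> * t)) * damped_deriv \<epsilon> F (Suc k) 0 t) (at t within {0..})"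
    by (simp add: algebra_simps)
qed

text \<open>Expanding the \<open>k\<close>-th power of d/dt - \<epsilon> gives coefficients of total
  size (1 + \<epsilon>)^k, of which the leading one accounts for 1. The starting order
  \<open>j\<close> is kept general for the induction.\<close>

lemma damped_deriv_diff_le:
  assumes "\<epsilon> \<ge> 0" "w \<ge> 0" and B: "\<And>i. i \<le> j + k \<Longrightarrow> w * cmod (F i t) \<le> B"
  shows "w * cmod (damped_deriv \<epsilon> F k j t - F (j + k) t) \<le> ((1 + \<epsilon>) ^ k - 1) * B"
  using B
proof (induction k arbitrary: j)
  case 0
  then show ?case by simp
next
  case (Suc k)
  define u where "u = damped_deriv \<epsilon> F k (Suc j) t"
  define v where "v = damped_deriv \<epsilon> F k j t"
  have u: "w * cmod (u - F (j + Suc k) t) \<le> ((1 + \<epsilon>) ^ k - 1) * B"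
    using Suc.IH[of "Suc j"] Suc.prems by (simp add: u_def)
  have v: "w * cmod (v - F (j + k) t) \<le> ((1 + \<epsilon>) ^ k - 1) * B"
    using Suc.IH[of j] Suc.prems by (simp add: v_def)
  have "w * cmod (damped_deriv \<epsilon> F (Suc k) j t - F (j + Suc k) t)
      = w * cmod ((u - F (j + Suc k) t) - of_real \<epsilon> * ((v - F (j + k) t) + F (j + k) t))"
  proof -
    have "damped_deriv \<epsilon> F (Suc k) j t - F (j + Suc k) t
        = (u - F (j + Suc k) t) - of_real \<epsilon> * ((v - F (j + k) t) + F (j + k) t)"
      by (simp add: u_def v_def)
    then show ?thesis by (simp only:)
  qed
  also have "\<dots> \<le> w * (cmod (u - F (j + Suc k) t) + \<epsilon> * (cmod (v - F (j + k) t) + cmod (F (j + k) t)))"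
  proof -
    have "cmod (a - of_real \<epsilon> * (b + c)) \<le> cmod a + \<epsilon> * (cmod b + cmod c)" for a b c
    proof -
      have "cmod (of_real \<epsilon> * (b + c)) \<le> \<epsilon> * (cmod b + cmod c)"
        using assms(1) norm_triangle_ineq[of b c] by (simp add: norm_mult mult_left_mono)
      with norm_triangle_ineq4[of a "of_real \<epsilon> * (b + c)"] show ?thesis by linarith
    qed
    then show ?thesis using assms(2) by (intro mult_left_mono)
  qed
  also have "\<dots> = w * cmod (u - F (j + Suc k) t) + \<epsilon> * (w * cmod (v - F (j + k) t) + w * cmod (F (j + k) t))"
    by (simp add: algebra_simps)
  also have "\<dots> \<le> ((1 + \<epsilon>) ^ k - 1) * B + \<epsilon> * (((1 + \<epsilon>) ^ k - 1) * B + B)"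
    using u v Suc.prems[of "j + k"] assms(1) by (intro add_mono mult_left_mono) auto
  finally show ?case by (simp add: algebra_simps)
qed

definition damp :: "real \<Rightarrow> (real \<Rightarrow> complex) \<Rightarrow> real \<Rightarrow> complex" where
  "damp \<epsilon> f t = of_real (exp (- \<epsilon> * t)) * f t"

text \<open>The difference 1 - exp(-\<epsilon> t) is small only relative to t, being at most
  \<epsilon> t. The extra factor t is paid by the next seminorm, hence \<open>Suc l\<close>.\<close>

lemma schwartz_norm_damp_diff_le:
  assumes f: "smooth_halfline f" and "\<epsilon> \<ge> 0"
    and B: "schwartz_norm (Suc l) f \<le> ereal B" and k: "k \<le> l" and t: "t \<ge> 0"
  shows "(1 + t) ^ l * cmod (of_real (exp (- \<epsilon> * t)) * damped_deriv \<epsilon> (\<lambda>k. D k f) k 0 t - D k f t)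
    \<le> ((1 + \<epsilon>) ^ l - 1 + \<epsilon>) * B"
proof -
  have B1: "(1 + t) * ((1 + t) ^ l * cmod (D i f t)) \<le> B" if "i \<le> l" for i
    using B that t by (auto simp: schwartz_norm_le_iff mult_ac)
  have B0: "(1 + t) ^ l * cmod (D i f t) \<le> B" if "i \<le> l" for i
  proof -
    have "1 * ((1 + t) ^ l * cmod (D i f t)) \<le> (1 + t) * ((1 + t) ^ l * cmod (D i f t))"
      using t by (intro mult_right_mono) auto
    with B1[OF that] show ?thesis by simp
  qed
  have "0 \<le> B" using order_trans[OF _ B0[of 0]] t by simp
  define u where "u = damped_deriv \<epsilon> (\<lambda>k. D k f) k 0 t"
  define v where "v = D k f t"
  define e where "e = exp (- \<epsilon> * t)"
  have e: "0 \<le> e" "e \<le> 1" "1 - e \<le> \<epsilon> * t"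
    using assms(2) t exp_ge_add_one_self[of "- \<epsilon> * t"] by (auto simp: e_def mult_nonneg_nonneg)
  have "(1 + t) ^ l * cmod (u - v) \<le> ((1 + \<epsilon>) ^ k - 1) * B"
    using damped_deriv_diff_le[of \<epsilon> "(1 + t) ^ l" 0 k "\<lambda>k. D k f" t B] assms(2) t k B0
    by (simp add: u_def v_def)
  also have "\<dots> \<le> ((1 + \<epsilon>) ^ l - 1) * B"
    using \<open>0 \<le> B\<close> assms(2) k by (intro mult_right_mono diff_right_mono power_increasing) auto
  finally have uv: "(1 + t) ^ l * cmod (u - v) \<le> ((1 + \<epsilon>) ^ l - 1) * B" .
  have "of_real e * u - v = of_real e * (u - v) - of_real (1 - e) * v"
    by (simp add: algebra_simps)
  then have "cmod (of_real e * u - v) \<le> e * cmod (u - v) + (1 - e) * cmod v"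
    using norm_triangle_ineq4[of "of_real e * (u - v)" "of_real (1 - e) * v"] e
    by (simp only: norm_mult norm_of_real abs_of_nonneg)
  also have "\<dots> \<le> 1 * cmod (u - v) + \<epsilon> * t * cmod v"
    using e by (intro add_mono mult_right_mono) auto
  finally have "(1 + t) ^ l * cmod (of_real e * u - v) \<le> (1 + t) ^ l * (cmod (u - v) + \<epsilon> * t * cmod v)"
    using t by (intro mult_left_mono) auto
  also have "\<dots> = (1 + t) ^ l * cmod (u - v) + \<epsilon> * (t * ((1 + t) ^ l * cmod v))"
    by (simp add: algebra_simps)
  also have "\<dots> \<le> ((1 + \<epsilon>) ^ l - 1) * B + \<epsilon> * B"
  proof (intro add_mono uv mult_left_mono)
    have "t * ((1 + t) ^ l * cmod v) \<le> (1 + t) * ((1 + t) ^ l * cmod v)"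
      using t by (intro mult_right_mono) auto
    with B1[OF k] show "t * ((1 + t) ^ l * cmod v) \<le> B" by (simp add: v_def)
  qed (rule assms(2))
  finally show ?thesis by (simp add: u_def v_def e_def algebra_simps)
qed

lemma
  assumes f: "f \<in> schwartz_halfline" and \<epsilon>: "\<epsilon> \<ge> 0"
  shows damp_in_schwartz: "damp \<epsilon> f \<in> schwartz_halfline"
    and schwartz_norm_damp_diff: "schwartz_norm (Suc l) f \<le> ereal B \<Longrightarrow>
      schwartz_norm l (\<lambda>t. damp \<epsilon> f t - f t) \<le> ereal (((1 + \<epsilon>) ^ l - 1 + \<epsilon>) * B)"
proof -
  note sm = schwartz_halfline_smooth[OF f]
  let ?G = "\<lambda>k t. of_real (exp (- \<epsilon> * t)) * damped_deriv \<epsilon> (\<lambda>k. D k f) k 0 t"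
  have G: "deriv_chain ?G"
    using sm by (intro deriv_chain_damped) (simp add: smooth_halfline_iff_chain)
  have G0: "\<forall>t\<ge>0. damp \<epsilon> f t = ?G 0 t" by (simp add: damp_def higher_vderiv_def)
  have smd: "smooth_halfline (damp \<epsilon> f)" by (rule smooth_halflineI[OF G G0])
  have d: "D k (\<lambda>t. damp \<epsilon> f t - f t) t = ?G k t - D k f t" if "t \<ge> 0" for k t
    using higher_vderiv_lincomb[OF smd sm that, of k "-1"] higher_vderiv_eq_chain[OF G G0 that] by simp
  show *: "schwartz_norm (Suc l) f \<le> ereal B \<Longrightarrow>
      schwartz_norm l (\<lambda>t. damp \<epsilon> f t - f t) \<le> ereal (((1 + \<epsilon>) ^ l - 1 + \<epsilon>) * B)" for l B
    using schwartz_norm_damp_diff_le[OF sm \<epsilon>, of l B] by (simp add: schwartz_norm_le_iff d)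
  have "schwartz_norm l (damp \<epsilon> f) < \<infinity>" for l
  proof -
    obtain A where A: "schwartz_norm l f = ereal A" using schwartz_norm_boundE[OF f] by blast
    obtain B where B: "schwartz_norm (Suc l) f = ereal B" using schwartz_norm_boundE[OF f] by blast
    have smdf: "smooth_halfline (\<lambda>t. damp \<epsilon> f t - f t)"
    proof (rule smooth_halflineI)
      show "deriv_chain (\<lambda>k t. D k (damp \<epsilon> f) t + (- 1) * D k f t)" by (rule deriv_chain_lincomb[OF smd sm])
    qed (simp add: higher_vderiv_def)
    have "schwartz_norm l (\<lambda>t. (damp \<epsilon> f t - f t) + f t) \<le> ereal (((1 + \<epsilon>) ^ l - 1 + \<epsilon>) * B + A)"
      using A B by (intro schwartz_norm_triangle smdf sm *) auto
    then have "schwartz_norm l (damp \<epsilon> f) \<le> ereal (((1 + \<epsilon>) ^ l - 1 + \<epsilon>) * B + A)" by simp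
    then show ?thesis by (rule order.strict_trans1) simp
  qed
  then show "damp \<epsilon> f \<in> schwartz_halfline"
    using f smd by (simp add: schwartz_halfline_def damp_def)
qed

text \<open>The exponential absorbs the whole power t^n, at the price n! / \<epsilon>^n; only a
  seminorm of \<open>f\<close> whose index does not depend on \<open>n\<close> is left.\<close>

lemma cmod_moment_damp_le:
  assumes f: "f \<in> schwartz_halfline" and \<epsilon>: "\<epsilon> > 0" and B: "schwartz_norm 2 f \<le> ereal B"
  shows "cmod (moment n (damp \<epsilon> f) x) \<le> B * (fact n * (1 / \<epsilon>) ^ n)"
proof (rule cmod_moment_le_weight)
  fix t :: real assume t: "t \<ge> 0"
  have *: "(1 + t)\<^sup>2 * cmod (f t) \<le> B"
    using B t schwartz_weight_le[of 0 f B t] by (simp add: numeral_2_eq_2)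
  have "(1 + t)\<^sup>2 * (t ^ n * cmod (damp \<epsilon> f t)) = (t ^ n * exp (- \<epsilon> * t)) * ((1 + t)\<^sup>2 * cmod (f t))"
    by (simp add: damp_def norm_mult)
  also have "\<dots> \<le> fact n / \<epsilon> ^ n * B"
    using t \<epsilon> * by (intro mult_mono power_mult_exp_minus_le) auto
  finally show "(1 + t)\<^sup>2 * (t ^ n * cmod (damp \<epsilon> f t)) \<le> B * (fact n * (1 / \<epsilon>) ^ n)"
    by (simp add: power_divide mult_ac)
qed (use f \<epsilon> in \<open>auto intro: damp_in_schwartz\<close>)

lemma taylor_growth_damp_add:
  assumes f: "f \<in> schwartz_halfline" and h: "h \<in> schwartz_halfline" and "\<epsilon> > 0" "c > 0"
    and inf: "taylor_growth h \<alpha> = \<infinity>"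
  shows "taylor_growth (\<lambda>t. damp \<epsilon> f t + of_real c * h t) \<alpha> = \<infinity>"
proof -
  have fd: "damp \<epsilon> f \<in> schwartz_halfline" using f assms(3) by (intro damp_in_schwartz) auto
  obtain B where B: "B \<ge> 0" "schwartz_norm 2 f = ereal B" using schwartz_norm_boundE[OF f] by blast
  show ?thesis
    unfolding taylor_growth_eq_infinity_iff[OF schwartz_halfline_lincomb[OF fd h]]
  proof (intro allI impI)
    fix C K :: real assume CK: "C \<ge> 0" "K \<ge> 0"
    \<comment> \<open>A geometric bound for the sum, combined with the one for the damped part,
      would give \<open>h\<close> a bound with base \<open>?K\<close> and constant
      \<open>(C + B) / c\<close>.\<close>
    let ?K = "max K (1 / \<epsilon>)"
    have "0 \<le> (C + B) / c" "0 \<le> ?K" using CK B assms by auto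
    then obtain n where n: "(C + B) / c * (fact n * ?K ^ n) < cmod (moment n h \<alpha>)"
      using inf unfolding taylor_growth_eq_infinity_iff[OF h] by blast
    have "C * (fact n * K ^ n) + B * (fact n * (1 / \<epsilon>) ^ n) \<le> C * (fact n * ?K ^ n) + B * (fact n * ?K ^ n)"
      using CK B assms by (intro add_mono mult_left_mono power_mono) auto
    also have "\<dots> = c * ((C + B) / c * (fact n * ?K ^ n))"
      using assms by (simp add: distrib_right)
    also have "\<dots> < c * cmod (moment n h \<alpha>)" using n assms by (intro mult_strict_left_mono) auto
    also have "\<dots> = cmod (of_real c * moment n h \<alpha>)" using assms by (simp add: norm_mult)
    also have "of_real c * moment n h \<alpha> = moment n (\<lambda>t. damp \<epsilon> f t + of_real c * h t) \<alpha> - moment n (damp \<epsilon> f) \<alpha>"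
      by (simp add: moment_lincomb fd h)
    also have "cmod \<dots> \<le> cmod (moment n (\<lambda>t. damp \<epsilon> f t + of_real c * h t) \<alpha>) + cmod (moment n (damp \<epsilon> f) \<alpha>)"
      by (rule norm_triangle_ineq4)
    also have "cmod (moment n (damp \<epsilon> f) \<alpha>) \<le> B * (fact n * (1 / \<epsilon>) ^ n)"
      using B assms by (intro cmod_moment_damp_le) auto
    finally show "\<exists>n. C * (fact n * K ^ n) < cmod (moment n (\<lambda>t. damp \<epsilon> f t + of_real c * h t) \<alpha>)"
      by (intro exI[of _ n]) simp
  qed
qed

section \<open>Density and the countable intersection\<close>

lemma exists_divergent_taylor_near:
  assumes f: "f \<in> schwartz_halfline" and "e > 0"
  shows "\<exists>g\<in>schwartz_ball l f e. \<forall>\<alpha>. taylor_growth g \<alpha> = \<infinity>"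
proof -
  obtain h where h: "h \<in> schwartz_halfline" "\<And>\<alpha>. taylor_growth h \<alpha> = \<infinity>"
    using exists_divergent_taylor by blast
  obtain B where B: "schwartz_norm (Suc l) f = ereal B" using schwartz_norm_boundE[OF f] by blast
  obtain A where A: "A \<ge> 0" "schwartz_norm l h = ereal A" using schwartz_norm_boundE[OF h(1)] by blast
  have "((\<lambda>\<epsilon>. ((1 + \<epsilon>) ^ l - 1 + \<epsilon>) * B) \<longlongrightarrow> ((1 + 0) ^ l - 1 + 0) * B) (at_right 0)"
    by (intro tendsto_intros)
  then have "\<forall>\<^sub>F \<epsilon> in at_right 0. ((1 + \<epsilon>) ^ l - 1 + \<epsilon>) * B < e / 2"
    using \<open>e > 0\<close> by (intro order_tendstoD(2)) auto
  then have "\<forall>\<^sub>F \<epsilon> in at_right 0. 0 < \<epsilon> \<and> ((1 + \<epsilon>) ^ l - 1 + \<epsilon>) * B < e / 2"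
    by (intro eventually_conj eventually_at_right_less)
  then obtain \<epsilon> where \<epsilon>: "\<epsilon> > 0" "((1 + \<epsilon>) ^ l - 1 + \<epsilon>) * B < e / 2"
    using eventually_happens'[OF trivial_limit_at_right_real] by blast
  \<comment> \<open>Half of \<open>e\<close> goes to the damping and half to the multiple of
    \<open>h\<close>; the summand 1 keeps the denominator positive when \<open>A\<close> is
    0.\<close>
  define c where "c = e / (2 * (A + 1))"
  have c: "c > 0" "c * A < e / 2" using A \<open>e > 0\<close> by (auto simp: c_def field_simps)
  have fd: "damp \<epsilon> f \<in> schwartz_halfline" using f \<epsilon> by (intro damp_in_schwartz) auto
  let ?g = "\<lambda>t. damp \<epsilon> f t + of_real c * h t"
  have "schwartz_norm l (\<lambda>t. (damp \<epsilon> f t - f t) + of_real c * h t)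
      \<le> ereal (((1 + \<epsilon>) ^ l - 1 + \<epsilon>) * B + cmod (of_real c) * A)"
    using f h(1) fd A B \<epsilon>
    by (intro schwartz_norm_lincomb_le schwartz_halfline_smooth schwartz_halfline_diff schwartz_norm_damp_diff) auto
  also have "\<dots> < ereal e" using \<epsilon>(2) c by simp
  finally have "?g \<in> schwartz_ball l f e"
    using schwartz_halfline_lincomb[OF fd h(1), of "of_real c"]
    by (simp add: schwartz_ball_def algebra_simps)
  moreover have "\<forall>\<alpha>. taylor_growth ?g \<alpha> = \<infinity>"
    using taylor_growth_damp_add[OF f h(1) \<epsilon>(1) c(1) h(2)] by blast
  ultimately show ?thesis by blast
qed

section \<open>The set as a countable intersection of open sets\<close>

definition fast_growth_set :: "nat \<Rightarrow> (real \<Rightarrow> complex) set" where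
  "fast_growth_set N = {f \<in> schwartz_halfline.
     \<forall>\<alpha>. \<bar>\<alpha>\<bar> \<le> real N \<longrightarrow> (\<exists>n. cmod (moment n f \<alpha>) > real N * (fact n * real N ^ n))}"

text \<open>If no ball around \<open>f\<close> fits, functions outside the set tend to
  \<open>f\<close>, each with a point of [-N, N] where all its moments are small. Since
  \<open>cmod_moment_le\<close> is uniform in the point, the weak inequalities pass to
  \<open>f\<close> at a limit point, against the strict one required there.\<close>

lemma openin_fast_growth_set: "openin schwartz_topology (fast_growth_set N)"
  unfolding openin_schwartz_topology_iff
proof (intro conjI ballI)
  show "fast_growth_set N \<subseteq> schwartz_halfline" by (auto simp: fast_growth_set_def)
  fix f assume fU: "f \<in> fast_growth_set N"
  then have f: "f \<in> schwartz_halfline" by (simp add: fast_growth_set_def)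
  show "\<exists>l. \<exists>e>0. schwartz_ball l f e \<subseteq> fast_growth_set N"
  proof (rule ccontr)
    assume "\<not> ?thesis"
    \<comment> \<open>Index and radius of the ball depend on the same \<open>l\<close>, so each
      fixed seminorm of the difference is eventually controlled and tends to 0.\<close>
    then have "\<exists>g. g \<in> schwartz_ball l f (1 / real (Suc l)) \<and> g \<notin> fast_growth_set N" for l
      by (metis subsetI of_nat_0_less_iff zero_less_Suc zero_less_divide_1_iff)
    then obtain g where g: "\<And>l. g l \<in> schwartz_ball l f (1 / real (Suc l))" "\<And>l. g l \<notin> fast_growth_set N"
      by metis
    have gS: "g l \<in> schwartz_halfline" for l using g(1)[of l] by (simp add: schwartz_ball_def)
    have "\<exists>\<alpha>. \<bar>\<alpha>\<bar> \<le> real N \<and> (\<forall>n. cmod (moment n (g l) \<alpha>) \<le> real N * (fact n * real N ^ n))" for l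
      using g(2)[of l] gS[of l] by (auto simp: fast_growth_set_def not_less)
    then obtain a where a: "\<And>l. \<bar>a l\<bar> \<le> real N"
      "\<And>l n. cmod (moment n (g l) (a l)) \<le> real N * (fact n * real N ^ n)"
      by metis
    have "\<forall>l. a l \<in> {- real N..real N}" using a(1) by (auto simp: abs_le_iff minus_le_iff)
    then obtain \<alpha> r where \<alpha>: "\<alpha> \<in> {- real N..real N}" and r: "strict_mono r" "(a \<circ> r) \<longlonglongrightarrow> \<alpha>"
      using compact_Icc[unfolded compact_def] by metis
    have "cmod (moment n f \<alpha>) \<le> real N * (fact n * real N ^ n)" for n
    proof (rule tendsto_le[OF sequentially_bot])
      have "isCont (moment n f) \<alpha>"
        using has_vector_derivative_continuous[OF has_vector_derivative_moment[OF f]] .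
      then show "(\<lambda>l. cmod (moment n f (a (r l)))) \<longlonglongrightarrow> cmod (moment n f \<alpha>)"
        using r(2) by (intro tendsto_norm isCont_tendsto_compose[of _ "moment n f"]) (simp_all add: o_def)
      have "(\<lambda>l. 1 / real (Suc (r l))) \<longlonglongrightarrow> 0"
        using LIMSEQ_subseq_LIMSEQ[OF LIMSEQ_inverse_real_of_nat r(1)] by (simp add: o_def inverse_eq_divide)
      then show "(\<lambda>l. real N * (fact n * real N ^ n) + 1 / real (Suc (r l))) \<longlonglongrightarrow> real N * (fact n * real N ^ n)"
        by (auto intro: tendsto_eq_intros)
      show "\<forall>\<^sub>F l in sequentially. cmod (moment n f (a (r l))) \<le> real N * (fact n * real N ^ n) + 1 / real (Suc (r l))"
        using eventually_ge_at_top[of "n + 2"]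
      proof eventually_elim
        case (elim l)
        then have "n + 2 \<le> r l" using strict_mono_imp_increasing[OF r(1), of l] by simp
        then have "schwartz_norm (n + 2) (\<lambda>t. g (r l) t - f t) \<le> schwartz_norm (r l) (\<lambda>t. g (r l) t - f t)"
          by (rule schwartz_norm_mono)
        also have "\<dots> \<le> ereal (1 / real (Suc (r l)))"
          using g(1)[of "r l"] by (simp add: schwartz_ball_def less_imp_le)
        finally have "cmod (moment n (\<lambda>t. g (r l) t - f t) (a (r l))) \<le> 1 / real (Suc (r l))"
          by (intro cmod_moment_le schwartz_halfline_diff gS f)
        moreover have "moment n f (a (r l)) = moment n (g (r l)) (a (r l)) - moment n (\<lambda>t. g (r l) t - f t) (a (r l))"
          using moment_lincomb[OF gS f, of n "r l" "-1"] by simp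
        ultimately show ?case
          using a(2)[of n "r l"] norm_triangle_ineq4[of "moment n (g (r l)) (a (r l))" "moment n (\<lambda>t. g (r l) t - f t) (a (r l))"]
          by simp
      qed
    qed
    moreover have "\<exists>n. cmod (moment n f \<alpha>) > real N * (fact n * real N ^ n)"
      using fU \<alpha> by (auto simp: fast_growth_set_def abs_le_iff)
    ultimately show False by (meson not_le)
  qed
qed

lemma divergent_taylor_set_eq:
  "{f \<in> schwartz_halfline. \<forall>\<alpha>. taylor_growth f \<alpha> = \<infinity>} = (\<Inter>N. fast_growth_set N)"
proof (intro equalityI subsetI)
  fix f assume "f \<in> {f \<in> schwartz_halfline. \<forall>\<alpha>. taylor_growth f \<alpha> = \<infinity>}"
  then show "f \<in> (\<Inter>N. fast_growth_set N)"
    using taylor_growth_eq_infinity_iff[of f] by (simp add: fast_growth_set_def)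
next
  fix f assume f: "f \<in> (\<Inter>N. fast_growth_set N)"
  then have fS: "f \<in> schwartz_halfline" by (auto simp: fast_growth_set_def)
  have "taylor_growth f \<alpha> = \<infinity>" for \<alpha>
    unfolding taylor_growth_eq_infinity_iff[OF fS]
  proof (intro allI impI)
    fix C K :: real assume CK: "C \<ge> 0" "K \<ge> 0"
    \<comment> \<open>A single natural number bounds the point, the constant and the base, so one
      countable family replaces three real quantifiers.\<close>
    obtain N where "max \<bar>\<alpha>\<bar> (max C K) \<le> real N" using real_arch_simple by blast
    then have N: "\<bar>\<alpha>\<bar> \<le> real N" "C \<le> real N" "K \<le> real N" by auto
    then obtain n where n: "real N * (fact n * real N ^ n) < cmod (moment n f \<alpha>)"
      using f by (auto simp: fast_growth_set_def)
    have "C * (fact n * K ^ n) \<le> real N * (fact n * real N ^ n)"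
      using N CK by (intro mult_mono mult_left_mono power_mono) auto
    with n show "\<exists>n. C * (fact n * K ^ n) < cmod (moment n f \<alpha>)" by (meson order.strict_trans1)
  qed
  with fS show "f \<in> {f \<in> schwartz_halfline. \<forall>\<alpha>. taylor_growth f \<alpha> = \<infinity>}" by blast
qed

theorem theorem1:
  "schwartz_topology closure_of {f \<in> schwartz_halfline. \<forall>\<alpha>::real. taylor_growth f \<alpha> = \<infinity>}
     = topspace schwartz_topology
   \<and> gdelta_in schwartz_topology {f \<in> schwartz_halfline. \<forall>\<alpha>::real. taylor_growth f \<alpha> = \<infinity>}"
proof
  show "gdelta_in schwartz_topology {f \<in> schwartz_halfline. \<forall>\<alpha>::real. taylor_growth f \<alpha> = \<infinity>}"
    unfolding divergent_taylor_set_eq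
    by (rule gdelta_in_Inter) (auto intro: open_imp_gdelta_in openin_fast_growth_set)
  show "schwartz_topology closure_of {f \<in> schwartz_halfline. \<forall>\<alpha>::real. taylor_growth f \<alpha> = \<infinity>}
      = topspace schwartz_topology"
  proof (intro equalityI closure_of_subset_topspace subsetI)
    fix f assume "f \<in> topspace schwartz_topology"
    then have f: "f \<in> schwartz_halfline" by (simp add: topspace_schwartz_topology)
    show "f \<in> schwartz_topology closure_of {f \<in> schwartz_halfline. \<forall>\<alpha>::real. taylor_growth f \<alpha> = \<infinity>}"
      unfolding in_closure_of
    proof (intro conjI allI impI)
      show "f \<in> topspace schwartz_topology" using f by (simp add: topspace_schwartz_topology)
      fix T assume "f \<in> T \<and> openin schwartz_topology T"
      then obtain l e where "e > 0" and T: "schwartz_ball l f e \<subseteq> T"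
        by (auto simp: openin_schwartz_topology_iff)
      obtain g where g: "g \<in> schwartz_ball l f e" "\<forall>\<alpha>. taylor_growth g \<alpha> = \<infinity>"
        using exists_divergent_taylor_near[OF f \<open>e > 0\<close>] by blast
      moreover have "g \<in> schwartz_halfline" using g(1) by (simp add: schwartz_ball_def)
      ultimately show "\<exists>y. y \<in> {f \<in> schwartz_halfline. \<forall>\<alpha>. taylor_growth f \<alpha> = \<infinity>} \<and> y \<in> T"
        using T by blast
    qed
  qed
qed

end
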